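(* Let $(P_{n,k}:n\ge1,\ 1\le k\le n)$ be an array of i.i.d. random variables in $[0,1]$ (fully random case), and let $G_n$ be the (random) empirical distribution of the break points of the split-merge dynamics with splitting proportions $(P_{n,k})$. Set $$\bar p=\mathbb{E}(P_{1,1}),\qquad s=\bar p(1-\bar p)$$ and assume that $\mathbb{P}(P_{1,1}\in(0,1))>0$. Then, almost surely, the sequence $(\sqrt n\,G_n/\sqrt s)$ of Radon measures on $(0,1)$ converges vaguely on $(0,1)$ to the Radon measure with density $Q'$ with respect to Lebesgue measure.
   Context: Given random splitting proportions $(P_{n,k}:n\ge1,\ 1\le k\le n)$ in $[0,1]$, the break points of the split-merge dynamics are defined by $A_{n,0}=0$, $A_{n,n+1}=1$ for all $n\ge0$, and recursively for $n\ge1$, $$A_{n,k}=P_{n,k}\,A_{n-1,k-1}+(1-P_{n,k})\,A_{n-1,k},\qquad k=1,\dots,n.$$ The empirical distribution of the break points is $G_n=\frac1n\sum_{k=1}^n\delta_{A_{n,k}}$ for $n\ge1$, where $\delta_a$ is the unit mass at $a$; here it is restricted to $(0,1)$. $Q=\Phi^{-1}:(0,1)\to\mathbb{R}$ is the quantile function of the standard normal distribution, where $\Phi$ is the standard normal cumulative distribution function. Vague convergence on $(0,1)$ means convergence of integrals of every continuous function with compact support in $(0,1)$. *)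

theory Defs
  imports "HOL-Probability.Probability"
begin

text \<open>
  Only the indices \<open>k \<le> n + 1\<close> are meaningful; \<open>break_point P n k = 1\<close> for \<open>k > n + 1\<close>
  is junk that never enters the recursion for meaningful indices.
\<close>

fun break_point :: "(nat \<Rightarrow> nat \<Rightarrow> real) \<Rightarrow> nat \<Rightarrow> nat \<Rightarrow> real" where
  "break_point P 0 k = (if k = 0 then 0 else 1)"
| "break_point P (Suc n) k =
     (if k = 0 then 0
      else if k \<le> Suc n then
        P (Suc n) k * break_point P n (k - 1) + (1 - P (Suc n) k) * break_point P n k
      else 1)"

text \<open>The null measure for \<open>n = 0\<close>, because \<open>1 / 0 = 0\<close>.\<close>

definition empirical_measure :: "nat \<Rightarrow> (nat \<Rightarrow> real) \<Rightarrow> real measure" where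
  "empirical_measure n a =
     measure_of UNIV (sets borel)
       (\<lambda>B. ennreal (1 / real n) * (\<Sum>k=1..n. emeasure (return borel (a k)) B))"

text \<open>The next two facts confirm that the set function above is a measure.\<close>

lemma sets_empirical_measure [simp, measurable_cong]:
  "sets (empirical_measure n a) = sets borel"
  unfolding empirical_measure_def
  by (metis sets.sigma_sets_eq sets_measure_of sets.space_closed space_borel)

lemma emeasure_empirical_measure:
  assumes "B \<in> sets borel"
  shows "emeasure (empirical_measure n a) B =
    ennreal (1 / real n) * (\<Sum>k=1..n. emeasure (return borel (a k)) B)"
proof (rule emeasure_measure_of[OF empirical_measure_def])
  show "countably_additive (sets (empirical_measure n a))
     (\<lambda>B. ennreal (1 / real n) * (\<Sum>k=1..n. emeasure (return borel (a k)) B))"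
  proof (rule countably_additiveI)
    fix F :: "nat \<Rightarrow> real set"
    assume F: "range F \<subseteq> sets (empirical_measure n a)" "disjoint_family F"
    then have "(\<Sum>i. emeasure (return borel (a k)) (F i)) =
        emeasure (return borel (a k)) (\<Union>i. F i)" for k
      by (intro suminf_emeasure) auto
    then show "(\<Sum>i. ennreal (1 / real n) * (\<Sum>k=1..n. emeasure (return borel (a k)) (F i)))
      = ennreal (1 / real n) * (\<Sum>k=1..n. emeasure (return borel (a k)) (\<Union>i. F i))"
      by (simp add: ennreal_suminf_cmult suminf_sum)
  qed
qed (use assms in \<open>auto simp: positive_def\<close>)

definition break_empirical :: "(nat \<Rightarrow> nat \<Rightarrow> real) \<Rightarrow> nat \<Rightarrow> real measure" where
  "break_empirical P n =
     restrict_space (empirical_measure n (break_point P n)) {0<..<1}"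

definition std_normal_cdf :: "real \<Rightarrow> real" where
  "std_normal_cdf = cdf std_normal_distribution"

text \<open>Meaningful only on \<open>{0<..<1}\<close>, the range of the (injective) function inverted here.\<close>

definition std_normal_quantile :: "real \<Rightarrow> real" where
  "std_normal_quantile = inv std_normal_cdf"

text \<open>
  On an open subset of the real line, the Radon measures are exactly the Borel measures that
  are finite on compact sets (regularity is automatic).
\<close>

definition radon_on :: "real set \<Rightarrow> real measure \<Rightarrow> bool" where
  "radon_on S M \<longleftrightarrow>
     sets M = sets (restrict_space borel S) \<and>
     (\<forall>K. compact K \<and> K \<subseteq> S \<longrightarrow> emeasure M K < \<infinity>)"

text \<open>
  The Radon conditions make every integral below a genuine one, rather than the default value
  \<open>0\<close> of the Bochner integral. Values of \<open>f\<close> outside \<open>S\<close> are irrelevant.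
\<close>

definition vague_conv_on :: "real set \<Rightarrow> (nat \<Rightarrow> real measure) \<Rightarrow> real measure \<Rightarrow> bool" where
  "vague_conv_on S \<mu> \<nu> \<longleftrightarrow>
     (\<forall>n. radon_on S (\<mu> n)) \<and> radon_on S \<nu> \<and>
     (\<forall>f :: real \<Rightarrow> real.
        continuous_on S f \<and> (\<exists>K. compact K \<and> K \<subseteq> S \<and> (\<forall>x\<in>S - K. f x = 0)) \<longrightarrow>
        (\<lambda>n. \<integral>x. f x \<partial>(\<mu> n)) \<longlonglongrightarrow> (\<integral>x. f x \<partial>\<nu>))"

end

theory Submission
  imports Defs "HOL-Real_Asymp.Real_Asymp"
begin

text \<open>
  Write \<open>A n k\<close> for the break points. Read backwards in time, the recursion says that \<open>A n k\<close> is the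
  probability, given the splitting proportions, that a walk which starts at \<open>k\<close> and at time \<open>m\<close> makes
  a unit step down with probability \<open>P m j\<close> when it is at \<open>j\<close> ends at a positive site. It is a
  random walk in an i.i.d. space-time environment, and averaging over the environment gives the
  binomial walk with success probability \<open>p = E P\<close>. So the mean of \<open>A n k\<close> is the probability that a
  binomial variable is less than \<open>k\<close>, and by the central limit theorem it tends to \<open>\<Phi> x\<close> along the
  window \<open>k \<approx> n p + x \<surd>(n s)\<close>. If almost surely the random \<open>A n k\<close> do the same for every \<open>x\<close>, the theorem
  follows: the sum \<open>1 / \<surd>(n s) \<Sum>\<^sub>k f (A n k)\<close> is the integral over \<open>x\<close> of \<open>f\<close> at the break point in the
  window of \<open>x\<close>, dominated convergence gives the limit \<open>\<integral> f (\<Phi> x) dx\<close>, and the substitution \<open>x = Q u\<close>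
  turns this into \<open>\<integral> f u Q' u du\<close> (\<open>vague_conv_break_empirical\<close>).

  What has to be proved is the almost sure convergence (\<open>AE_break_point_tendsto\<close>).

  First, the variance of \<open>A n k\<close> decays like a power of \<open>n\<close>. The covariances of the deviations
  \<open>D n k = A n k - E (A n k)\<close> obey a linear recursion driven by two walks in the same environment:
  at every collision of the two walks a term \<open>Var P\<close> times a squared binomial weight enters
  (\<open>dev_cov_step_distinct\<close>, \<open>dev_cov_step_equal\<close>). Binomial weights are \<open>O (1 / \<surd>n)\<close>
  (\<open>binom_weight_le\<close>). The expected number of collisions up to time \<open>t\<close> is at most \<open>\<surd>t / (2 \<theta>)\<close>, where
  \<open>\<theta> = E (P (1 - P))\<close> is positive precisely because \<open>P\<close> takes values in \<open>(0, 1)\<close> with positive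
  probability. The bound is Tanaka's formula: the distance of the walks is a martingale except
  that it grows by \<open>2 \<theta>\<close> on average at each collision, and its square grows by at most \<open>1\<close> per step.
  Instead of the two walks the proof uses an explicit supersolution of the recursion
  (\<open>sojourn_bound_step\<close>). The bound on the collisions times the squared weights is only useful from
  some level \<open>L\<close> on; the covariances present at level \<open>L\<close> have total mass \<open>O (\<surd>L)\<close> on the diagonal and
  are spread out by the remaining \<open>n - L\<close> steps. Together this gives the bound
  \<open>O (\<surd>L / \<surd>(n - L) + \<surd>(n - L) / L)\<close> (\<open>dev_cov_decay\<close>).

  Secondly, along \<open>n = i ^ 12\<close>, with \<open>L = i ^ 8\<close>, these variances are summable, which gives convergence
  at these times (\<open>AE_tendsto_at_block_starts\<close>). Between \<open>m = i ^ 12\<close> and the next such time there are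
  \<open>r = O (i ^ 11)\<close> steps, which is much less than \<open>m\<close>, so the walk deviates from its mean displacement by
  less than a small multiple of the window width \<open>\<surd>m\<close>, except with a probability that is exponentially
  small in \<open>i\<close>; monotonicity in \<open>k\<close> then carries the convergence to all times (\<open>expectation_excess_le\<close>,
  \<open>AE_excess_over_block_start_tendsto_0\<close>).
\<close>

section \<open>Break points and the binomial walk\<close>

lemma break_point_0 [simp]: "break_point P n 0 = 0"
  by (cases n) auto

lemma break_point_beyond: "n < k \<Longrightarrow> break_point P n k = 1"
  by (cases n) auto

text \<open>
  The value \<open>1\<close> of \<open>break_point P n k\<close> for \<open>k > n + 1\<close> makes the recursion hold for all positive
  indices, whatever \<open>P\<close> is there, so that no upper bound on \<open>k\<close> has to be carried along.
\<close>

lemma break_point_Suc_Suc: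
  "break_point P (Suc n) (Suc k) =
     P (Suc n) (Suc k) * break_point P n k + (1 - P (Suc n) (Suc k)) * break_point P n (Suc k)"
  by (auto simp: break_point_beyond)

declare break_point.simps(2) [simp del]

text \<open>
  Each new break point is a convex combination of two neighbouring old ones, so the old and the new
  break points interlace.
\<close>

lemma break_point_mono:
  assumes "\<And>m j. 1 \<le> j \<Longrightarrow> j \<le> m \<Longrightarrow> P m j \<in> {0..1}" and "k \<le> l"
  shows "break_point P n k \<le> break_point P n l"
proof -
  have "break_point P n k \<le> break_point P n (Suc k)" for k
  proof (induction n arbitrary: k)
    case 0
    show ?case by auto
  next
    case (Suc n)
    have between: "break_point P n j \<le> break_point P (Suc n) (Suc j) \<and>
        break_point P (Suc n) (Suc j) \<le> break_point P n (Suc j)" for j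
    proof (cases "j \<le> n")
      case True
      then have P: "P (Suc n) (Suc j) \<in> {0..1}"
        by (intro assms(1)) auto
      have "P (Suc n) (Suc j) * break_point P n j \<le> P (Suc n) (Suc j) * break_point P n (Suc j)"
        "(1 - P (Suc n) (Suc j)) * break_point P n j \<le>
         (1 - P (Suc n) (Suc j)) * break_point P n (Suc j)"
        using P Suc[of j] by (auto intro!: mult_left_mono)
      then show ?thesis
        unfolding break_point_Suc_Suc by (auto simp: algebra_simps)
    qed (auto simp: break_point_beyond)
    show ?case
    proof (cases k)
      case 0
      then show ?thesis using between[of 0] by simp
    next
      case (Suc j)
      then show ?thesis using between[of j] between[of "Suc j"] by auto
    qed
  qed
  then show ?thesis
    using \<open>k \<le> l\<close> by (rule lift_Suc_mono_le[of "break_point P n"])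
qed

lemma break_point_range:
  assumes "\<And>m j. 1 \<le> j \<Longrightarrow> j \<le> m \<Longrightarrow> P m j \<in> {0..1}"
  shows "break_point P n k \<in> {0..1}"
proof -
  have "break_point P n 0 \<le> break_point P n k" "break_point P n k \<le> break_point P n (k + Suc n)"
    by (rule break_point_mono[OF assms]; simp)+
  then show ?thesis by (simp add: break_point_beyond)
qed

text \<open>
  With constant proportions \<open>p\<close> the walk is a binomial walk, so this is the probability that a
  binomial variable with parameters \<open>n\<close> and \<open>p\<close> is \<^emph>\<open>strictly\<close> less than \<open>k\<close>. Working with
  the recursion rather than with binomial coefficients makes it directly comparable with random
  proportions.
\<close>

abbreviation binom_cdf :: "real \<Rightarrow> nat \<Rightarrow> nat \<Rightarrow> real" where
  "binom_cdf p \<equiv> break_point (\<lambda>_ _. p)"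

text \<open>
  The probability mass function of the binomial distribution.
\<close>

definition binom_weight :: "real \<Rightarrow> nat \<Rightarrow> nat \<Rightarrow> real" where
  "binom_weight p n k = binom_cdf p n (Suc k) - binom_cdf p n k"

lemma binom_weight_0: "binom_weight p 0 k = (if k = 0 then 1 else 0)"
  by (simp add: binom_weight_def)

lemma binom_weight_Suc_0: "binom_weight p (Suc n) 0 = (1 - p) * binom_weight p n 0"
  by (simp add: binom_weight_def break_point_Suc_Suc)

lemma binom_weight_Suc_Suc:
  "binom_weight p (Suc n) (Suc k) = p * binom_weight p n k + (1 - p) * binom_weight p n (Suc k)"
  by (simp add: binom_weight_def break_point_Suc_Suc algebra_simps)

lemma binom_weight_beyond: "n < k \<Longrightarrow> binom_weight p n k = 0"
  by (simp add: binom_weight_def break_point_beyond)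

lemma binom_weight_nonneg: "p \<in> {0..1} \<Longrightarrow> 0 \<le> binom_weight p n k"
  unfolding binom_weight_def by (simp add: break_point_mono)

text \<open>
  The averaging operator of \<open>n\<close> steps of the binomial walk, where functions on the natural numbers
  are extended by \<open>0\<close> to negative sites.
\<close>

definition binom_smooth :: "real \<Rightarrow> nat \<Rightarrow> (nat \<Rightarrow> real) \<Rightarrow> nat \<Rightarrow> real" where
  "binom_smooth p n f k = (\<Sum>j\<le>k. binom_weight p n (k - j) * f j)"

lemma binom_smooth_0: "binom_smooth p 0 f k = f k"
proof -
  have "(\<Sum>j\<le>k. binom_weight p 0 (k - j) * f j) = (\<Sum>j\<in>{k}. binom_weight p 0 (k - j) * f j)"
    by (rule sum.mono_neutral_right) (auto simp: binom_weight_0)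
  then show ?thesis
    by (simp add: binom_smooth_def binom_weight_0)
qed

lemma binom_smooth_Suc_0: "binom_smooth p (Suc n) f 0 = (1 - p) * binom_smooth p n f 0"
  by (simp add: binom_smooth_def binom_weight_Suc_0)

lemma binom_smooth_Suc_Suc:
  "binom_smooth p (Suc n) f (Suc k) = p * binom_smooth p n f k + (1 - p) * binom_smooth p n f (Suc k)"
proof -
  have "(\<Sum>j\<le>k. binom_weight p (Suc n) (Suc k - j) * f j) =
      (\<Sum>j\<le>k. p * (binom_weight p n (k - j) * f j) + (1 - p) * (binom_weight p n (Suc k - j) * f j))"
    by (intro sum.cong) (auto simp: Suc_diff_le binom_weight_Suc_Suc algebra_simps)
  also have "\<dots> = p * binom_smooth p n f k +
      (1 - p) * (\<Sum>j\<le>k. binom_weight p n (Suc k - j) * f j)"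
    unfolding binom_smooth_def by (simp only: sum.distrib sum_distrib_left)
  finally show ?thesis
    by (simp add: binom_smooth_def[of _ _ _ "Suc k"] binom_weight_Suc_0 distrib_left)
qed

lemma binom_weight_add: "binom_weight p (m + n) = binom_smooth p n (binom_weight p m)"
proof
  fix k
  show "binom_weight p (m + n) k = binom_smooth p n (binom_weight p m) k"
  proof (induction n arbitrary: k)
    case 0
    show ?case by (simp add: binom_smooth_0)
  next
    case (Suc n)
    show ?case
      using Suc by (cases k)
        (auto simp: binom_weight_Suc_0 binom_smooth_Suc_0 binom_weight_Suc_Suc binom_smooth_Suc_Suc)
  qed
qed

section \<open>Collisions of two walks and the local bound for binomial weights\<close>

text \<open>
  A bound for the expected number of visits to \<open>0\<close> before time \<open>t\<close> of the difference of two walks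
  that starts at \<open>d\<close>. If the difference \<open>Y\<close> has symmetric steps, and steps up and down with
  probability \<open>\<theta>\<close> each when it is at \<open>0\<close>, then \<open>\<bar>Y\<bar>\<close> gains \<open>2 * \<theta>\<close> on average at each visit to \<open>0\<close> and nothing elsewhere, so the expected
  number of visits is \<open>(E \<bar>Y t\<bar> - \<bar>d\<bar>) / (2 * \<theta>)\<close>; and \<open>E \<bar>Y t\<bar>\<close> is at most \<open>sqrt (d ^ 2 + t)\<close> because a
  step has variance at most \<open>1\<close>.
\<close>

definition sojourn_bound :: "real \<Rightarrow> nat \<Rightarrow> int \<Rightarrow> real" where
  "sojourn_bound \<theta> t d = (sqrt (real_of_int d ^ 2 + real t) - \<bar>real_of_int d\<bar>) / (2 * \<theta>)"

lemma sojourn_bound_nonneg: "0 < \<theta> \<Longrightarrow> 0 \<le> sojourn_bound \<theta> t d"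
proof -
  assume "0 < \<theta>"
  have "\<bar>real_of_int d\<bar> \<le> sqrt (real_of_int d ^ 2 + real t)"
    by (rule real_le_rsqrt) simp
  with \<open>0 < \<theta>\<close> show ?thesis by (simp add: sojourn_bound_def)
qed

lemma sojourn_bound_at_0: "sojourn_bound \<theta> t 0 = sqrt t / (2 * \<theta>)"
  by (simp add: sojourn_bound_def)

text \<open>
  Jensen's inequality for the square root and a symmetric lazy step of variance \<open>2 * a \<le> 1\<close>. After
  squaring, the defect is a combination of squares of differences.
\<close>

lemma sqrt_jensen_step:
  fixes a x c :: real
  assumes "0 \<le> a" "a \<le> 1/2" "0 \<le> c"
  shows "a * sqrt ((x - 1)\<^sup>2 + c) + (1 - 2 * a) * sqrt (x\<^sup>2 + c) + a * sqrt ((x + 1)\<^sup>2 + c)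
    \<le> sqrt (x\<^sup>2 + (c + 1))"
proof -
  define u v w where "u = sqrt ((x - 1)\<^sup>2 + c)" and "v = sqrt (x\<^sup>2 + c)"
    and "w = sqrt ((x + 1)\<^sup>2 + c)"
  have sq: "u\<^sup>2 = (x - 1)\<^sup>2 + c" "v\<^sup>2 = x\<^sup>2 + c" "w\<^sup>2 = (x + 1)\<^sup>2 + c"
    using assms by (simp_all add: u_def v_def w_def)
  have "(a * u + (1 - 2 * a) * v + a * w)\<^sup>2 \<le> a * u\<^sup>2 + (1 - 2 * a) * v\<^sup>2 + a * w\<^sup>2"
  proof -
    have "a * u\<^sup>2 + (1 - 2 * a) * v\<^sup>2 + a * w\<^sup>2 - (a * u + (1 - 2 * a) * v + a * w)\<^sup>2
      = a * (1 - 2 * a) * (u - v)\<^sup>2 + a * (1 - 2 * a) * (v - w)\<^sup>2 + a * a * (u - w)\<^sup>2"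
      by (simp add: power2_eq_square algebra_simps)
    moreover have "0 \<le> \<dots>"
      using assms by simp
    ultimately show ?thesis by linarith
  qed
  also have "\<dots> = x\<^sup>2 + c + 2 * a"
    unfolding sq by (simp add: power2_eq_square algebra_simps)
  also have "\<dots> \<le> x\<^sup>2 + (c + 1)"
    using assms by simp
  finally have "a * u + (1 - 2 * a) * v + a * w \<le> sqrt (x\<^sup>2 + (c + 1))"
    by (rule real_le_rsqrt)
  then show ?thesis by (simp add: u_def v_def w_def)
qed

text \<open>
  The supersolution property: one more step, plus one for a visit to \<open>0\<close>. The term \<open>sqrt (d ^ 2 + t)\<close>
  is handled by Jensen's inequality, and \<open>\<bar>d\<bar>\<close> is harmonic for the step except at \<open>0\<close>, where it creates
  exactly the required \<open>1\<close>. Away from \<open>0\<close> the step probability \<open>a\<close> is free: two walks are independent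
  when apart, but share the randomness when they meet.
\<close>

lemma sojourn_bound_step:
  assumes "0 < \<theta>" "0 \<le> a" "a \<le> 1/2" "d = 0 \<Longrightarrow> a = \<theta>"
  shows "a * sojourn_bound \<theta> t (d - 1) + (1 - 2 * a) * sojourn_bound \<theta> t d +
      a * sojourn_bound \<theta> t (d + 1) + (if d = 0 then 1 else 0) \<le> sojourn_bound \<theta> (Suc t) d"
proof -
  define x where "x = real_of_int d"
  have abs: "a * \<bar>x - 1\<bar> + (1 - 2 * a) * \<bar>x\<bar> + a * \<bar>x + 1\<bar> = \<bar>x\<bar> + (if d = 0 then 2 * \<theta> else 0)"
  proof -
    consider "d = 0" | "d \<ge> 1" | "d \<le> -1" by linarith
    then show ?thesis
    proof cases
      case 1
      then show ?thesis using assms(4) by (simp add: x_def)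
    next
      case 2
      then have "x \<ge> 1" by (simp add: x_def)
      then show ?thesis using 2 by (simp add: algebra_simps)
    next
      case 3
      then have "x \<le> - 1" by (simp add: x_def)
      then have "\<bar>x - 1\<bar> = 1 - x" "\<bar>x\<bar> = - x" "\<bar>x + 1\<bar> = - x - 1" by auto
      then show ?thesis using 3 by (simp add: algebra_simps)
    qed
  qed
  have "a * (sqrt ((x - 1)\<^sup>2 + t) - \<bar>x - 1\<bar>) + (1 - 2 * a) * (sqrt (x\<^sup>2 + t) - \<bar>x\<bar>) +
      a * (sqrt ((x + 1)\<^sup>2 + t) - \<bar>x + 1\<bar>) + (if d = 0 then 2 * \<theta> else 0)
      \<le> sqrt (x\<^sup>2 + (real t + 1)) - \<bar>x\<bar>"
    using sqrt_jensen_step[OF assms(2,3), of "real t" x] abs by (simp add: algebra_simps)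
  then have "(a * (sqrt ((x - 1)\<^sup>2 + t) - \<bar>x - 1\<bar>) + (1 - 2 * a) * (sqrt (x\<^sup>2 + t) - \<bar>x\<bar>) +
      a * (sqrt ((x + 1)\<^sup>2 + t) - \<bar>x + 1\<bar>) + (if d = 0 then 2 * \<theta> else 0)) / (2 * \<theta>)
      \<le> (sqrt (x\<^sup>2 + (real t + 1)) - \<bar>x\<bar>) / (2 * \<theta>)"
    using assms(1) by (intro divide_right_mono) auto
  then show ?thesis
    using assms(1) by (simp add: sojourn_bound_def x_def add_divide_distrib add.commute split: if_splits)
qed

text \<open>
  A step of the walk averages neighbouring weights, and averaging contracts the Euclidean norm.
\<close>

lemma sum_sq_binom_weight_antimono:
  assumes p: "p \<in> {0..1}" and "m \<le> n"
  shows "(\<Sum>k\<le>n. (binom_weight p n k)\<^sup>2) \<le> (\<Sum>k\<le>m. (binom_weight p m k)\<^sup>2)"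
proof -
  define c where "c n = (\<Sum>k\<le>n. (binom_weight p n k)\<^sup>2)" for n
  have convex: "(p * x + (1 - p) * y)\<^sup>2 \<le> p * x\<^sup>2 + (1 - p) * y\<^sup>2" for x y :: real
  proof -
    have "p * x\<^sup>2 + (1 - p) * y\<^sup>2 - (p * x + (1 - p) * y)\<^sup>2 = p * (1 - p) * (x - y)\<^sup>2"
      by (simp add: power2_eq_square algebra_simps)
    moreover have "0 \<le> p * (1 - p) * (x - y)\<^sup>2" using p by simp
    ultimately show ?thesis by linarith
  qed
  have "c (Suc n) \<le> c n" for n
  proof -
    have zero: "(\<Sum>k\<le>Suc n. (binom_weight p n k)\<^sup>2) = c n"
      by (simp add: c_def binom_weight_beyond)
    have "c (Suc n) = (binom_weight p (Suc n) 0)\<^sup>2 + (\<Sum>k\<le>n. (binom_weight p (Suc n) (Suc k))\<^sup>2)"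
      unfolding c_def by (rule sum.atMost_Suc_shift)
    also have "\<dots> \<le> (1 - p) * (binom_weight p n 0)\<^sup>2 +
        (\<Sum>k\<le>n. p * (binom_weight p n k)\<^sup>2 + (1 - p) * (binom_weight p n (Suc k))\<^sup>2)"
      using convex[of 0] convex
      by (intro add_mono sum_mono) (auto simp: binom_weight_Suc_0 binom_weight_Suc_Suc)
    also have "\<dots> = p * c n + (1 - p) * (\<Sum>k\<le>Suc n. (binom_weight p n k)\<^sup>2)"
      unfolding sum.atMost_Suc_shift c_def
      by (simp only: sum.distrib sum_distrib_left distrib_left add_ac)
    also have "\<dots> = c n"
      unfolding zero by (simp add: algebra_simps)
    finally show ?thesis .
  qed
  then have "c n \<le> c m"
    using \<open>m \<le> n\<close> by (rule lift_Suc_antimono_le[of c])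
  then show ?thesis by (simp add: c_def)
qed

text \<open>
  The sum of the squared weights is the probability that two independent binomial walks meet at
  time \<open>n\<close>. These probabilities decrease in time, and the first \<open>n\<close> of them sum to at most
  \<open>sqrt n / (2 * s)\<close> by the sojourn bound.
\<close>

lemma sum_sq_binom_weight_le:
  assumes p: "0 < p" "p < 1" and "0 < n"
  shows "(\<Sum>k\<le>n. (binom_weight p n k)\<^sup>2) \<le> 1 / (2 * (p * (1 - p)) * sqrt n)"
proof -
  define s where "s = p * (1 - p)"
  have s: "0 < s" "s \<le> 1/2"
  proof -
    have "s = 1/4 - (p - 1/2)\<^sup>2" by (simp add: s_def power2_eq_square algebra_simps)
    then have "s \<le> 1/4" using zero_le_power2[of "p - 1/2"] by linarith
    then show "s \<le> 1/2" by simp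
  qed (use p in \<open>simp add: s_def\<close>)
  \<comment> \<open>Extending the weights by 0 to all integers frees the recursion from a boundary case.\<close>
  define g :: "nat \<Rightarrow> int \<Rightarrow> real" where "g u k = (if k < 0 then 0 else binom_weight p u (nat k))" for u k
  have g_Suc: "g (Suc u) k = p * g u (k - 1) + (1 - p) * g u k" for u k
  proof -
    consider "k < 0" | "k = 0" | j where "k = int (Suc j)"
    proof -
      have "k < 0 \<or> k = 0 \<or> k = int (Suc (nat (k - 1)))" by auto
      then show thesis using that by blast
    qed
    then show ?thesis
      by cases (auto simp: g_def binom_weight_Suc_0 binom_weight_Suc_Suc nat_add_distrib)
  qed
  \<comment> \<open>The two walks start from k and l and are counted as meeting when both are at a site of J
    at the same time.\<close>
  have main: "(\<Sum>j\<in>J. \<Sum>u<t. g u (k - j) * g u (l - j)) \<le> sojourn_bound s t (k - l)"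
    if "finite J" for J :: "int set" and k l t
  proof (induction t arbitrary: k l)
    case 0
    then show ?case using sojourn_bound_nonneg[OF s(1)] by simp
  next
    case (Suc t)
    define v where "v k l = (\<Sum>j\<in>J. \<Sum>u<t. g u (k - j) * g u (l - j))" for k l
    have "(\<Sum>j\<in>J. g 0 (k - j) * g 0 (l - j)) \<le> (if k - l = 0 then 1 else 0)"
    proof -
      have "(\<Sum>j\<in>J. g 0 (k - j) * g 0 (l - j)) = (\<Sum>j\<in>J. if k = j then (if k - l = 0 then 1 else 0) else 0)"
        by (intro sum.cong) (auto simp: g_def binom_weight_0)
      also have "\<dots> \<le> (if k - l = 0 then 1 else 0)"
        using that by (simp add: sum.delta')
      finally show ?thesis .
    qed
    moreover have "(\<Sum>j\<in>J. \<Sum>u<Suc t. g u (k - j) * g u (l - j)) =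
        (\<Sum>j\<in>J. g 0 (k - j) * g 0 (l - j)) +
        (p * p * v (k - 1) (l - 1) + s * v (k - 1) l + s * v k (l - 1) + (1 - p) * (1 - p) * v k l)"
    proof -
      have "(\<Sum>u<Suc t. g u (k - j) * g u (l - j)) = g 0 (k - j) * g 0 (l - j) +
         (\<Sum>u<t. p * p * (g u (k - 1 - j) * g u (l - 1 - j)) + s * (g u (k - 1 - j) * g u (l - j)) +
           s * (g u (k - j) * g u (l - 1 - j)) + (1 - p) * (1 - p) * (g u (k - j) * g u (l - j)))" for j
        unfolding sum.lessThan_Suc_shift g_Suc
        by (simp add: s_def algebra_simps)
      then show ?thesis
        unfolding v_def by (simp add: sum.distrib sum_distrib_left)
    qed
    moreover have "p * p * v (k - 1) (l - 1) + s * v (k - 1) l + s * v k (l - 1) + (1 - p) * (1 - p) * v k l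
      \<le> p * p * sojourn_bound s t (k - l) + s * sojourn_bound s t (k - l - 1) +
        s * sojourn_bound s t (k - l + 1) + (1 - p) * (1 - p) * sojourn_bound s t (k - l)"
    proof -
      have "k - 1 - l = k - l - 1" "k - (l - 1) = k - l + 1" "k - 1 - (l - 1) = k - l"
        by auto
      then have "v (k - 1) (l - 1) \<le> sojourn_bound s t (k - l)"
        "v (k - 1) l \<le> sojourn_bound s t (k - l - 1)" "v k (l - 1) \<le> sojourn_bound s t (k - l + 1)"
        "v k l \<le> sojourn_bound s t (k - l)"
        using Suc[of "k - 1" "l - 1"] Suc[of "k - 1" l] Suc[of k "l - 1"] Suc[of k l]
        unfolding v_def by metis+
      then show ?thesis
        using p s by (intro add_mono mult_left_mono) auto
    qed
    moreover have "\<dots> + (if k - l = 0 then 1 else 0) \<le> sojourn_bound s (Suc t) (k - l)"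
      using sojourn_bound_step[of s s "k - l" t] s by (simp add: s_def algebra_simps)
    ultimately show ?case by linarith
  qed
  define c where "c u = (\<Sum>k\<le>u. (binom_weight p u k)\<^sup>2)" for u
  have "c u \<le> (\<Sum>j\<in>(\<lambda>k. - int k) ` {..n}. g u (0 - j) * g u (0 - j))" if "u < n" for u
  proof -
    have "(\<Sum>j\<in>(\<lambda>k. - int k) ` {..n}. g u (0 - j) * g u (0 - j)) = (\<Sum>k\<le>n. (binom_weight p u k)\<^sup>2)"
      by (subst sum.reindex) (auto simp: inj_on_def g_def power2_eq_square)
    moreover have "c u \<le> \<dots>"
      unfolding c_def using that by (intro sum_mono2) auto
    ultimately show ?thesis by simp
  qed
  then have "(\<Sum>u<n. c u) \<le> (\<Sum>u<n. \<Sum>j\<in>(\<lambda>k. - int k) ` {..n}. g u (0 - j) * g u (0 - j))"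
    by (intro sum_mono) auto
  also have "\<dots> = (\<Sum>j\<in>(\<lambda>k. - int k) ` {..n}. \<Sum>u<n. g u (0 - j) * g u (0 - j))"
    by (rule sum.swap)
  also have "\<dots> \<le> sqrt n / (2 * s)"
    using main[where t = n and k = 0 and l = 0] by (simp add: sojourn_bound_at_0)
  finally have "(\<Sum>u<n. c u) \<le> sqrt n / (2 * s)" .
  moreover have "(\<Sum>u<n. c n) \<le> (\<Sum>u<n. c u)"
    unfolding c_def using p by (intro sum_mono sum_sq_binom_weight_antimono) auto
  ultimately have "real n * c n \<le> sqrt n / (2 * s)"
    by simp
  then have "c n \<le> sqrt n / (2 * s) / real n"
    using \<open>0 < n\<close> by (subst pos_le_divide_eq) (auto simp: mult.commute)
  also have "\<dots> = 1 / (2 * s * sqrt n)"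
    using \<open>0 < n\<close> s by (simp add: field_simps)
  finally show ?thesis by (simp add: c_def s_def)
qed

lemma binom_weight_le_1:
  assumes "p \<in> {0..1}"
  shows "binom_weight p n k \<le> 1"
proof -
  have "binom_cdf p n (Suc k) \<in> {0..1}" "binom_cdf p n k \<in> {0..1}"
    using assms by (auto intro!: break_point_range simp del: atLeastAtMost_iff)
  then show ?thesis by (simp add: binom_weight_def)
qed

text \<open>
  Splitting the \<open>n\<close> steps into two halves makes the weight a convolution; each product in it is at most
  the mean of the two squares, and both square sums are at most the one at time \<open>n div 2\<close>.
\<close>

lemma binom_weight_le:
  assumes p: "0 < p" "p < 1" and "0 < n"
  shows "binom_weight p n k \<le> 1 / (p * (1 - p) * sqrt n)"
proof (cases "n = 1")
  case True
  have "p * (1 - p) \<le> 1"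
    using p by (simp add: mult_le_one)
  then have "1 \<le> 1 / (p * (1 - p))"
    using p by simp
  moreover have "binom_weight p n k \<le> 1"
    using p by (intro binom_weight_le_1) auto
  ultimately have "binom_weight p n k \<le> 1 / (p * (1 - p))"
    by linarith
  then show ?thesis
    using True by simp
next
  case False
  define h where "h = n div 2"
  define c where "c u = (\<Sum>k\<le>u. (binom_weight p u k)\<^sup>2)" for u
  have h: "0 < h" "h \<le> n - h" "n \<le> 4 * h" "h + (n - h) = n"
    using \<open>0 < n\<close> False by (auto simp: h_def)
  have partial: "(\<Sum>j\<le>k. (binom_weight p m j)\<^sup>2) \<le> c m" for m
  proof -
    have "(\<Sum>j\<le>k. (binom_weight p m j)\<^sup>2) \<le> (\<Sum>j\<le>k+m. (binom_weight p m j)\<^sup>2)"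
      by (intro sum_mono2) auto
    also have "\<dots> = c m"
      unfolding c_def by (intro sum.mono_neutral_right) (auto simp: binom_weight_beyond)
    finally show ?thesis .
  qed
  have "binom_weight p n k = (\<Sum>j\<le>k. binom_weight p (n - h) (k - j) * binom_weight p h j)"
    using binom_weight_add[of p h "n - h"] h by (simp add: binom_smooth_def)
  also have "\<dots> \<le> (\<Sum>j\<le>k. ((binom_weight p (n - h) (k - j))\<^sup>2 + (binom_weight p h j)\<^sup>2) / 2)"
  proof (intro sum_mono)
    fix j
    show "binom_weight p (n - h) (k - j) * binom_weight p h j \<le>
        ((binom_weight p (n - h) (k - j))\<^sup>2 + (binom_weight p h j)\<^sup>2) / 2"
      using sum_squares_bound[of "binom_weight p (n - h) (k - j)" "binom_weight p h j"] by simp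
  qed
  also have "\<dots> = ((\<Sum>j\<le>k. (binom_weight p (n - h) (k - j))\<^sup>2) + (\<Sum>j\<le>k. (binom_weight p h j)\<^sup>2)) / 2"
    by (simp add: sum.distrib sum_divide_distrib add_divide_distrib)
  also have "(\<Sum>j\<le>k. (binom_weight p (n - h) (k - j))\<^sup>2) = (\<Sum>j\<le>k. (binom_weight p (n - h) j)\<^sup>2)"
    by (rule sum.reindex_bij_witness[of _ "\<lambda>j. k - j" "\<lambda>j. k - j"]) auto
  also have "(\<dots> + (\<Sum>j\<le>k. (binom_weight p h j)\<^sup>2)) / 2 \<le> (c (n - h) + c h) / 2"
    using partial[of "n - h"] partial[of h] by simp
  also have "c (n - h) \<le> c h"
    unfolding c_def using h p by (intro sum_sq_binom_weight_antimono) auto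
  also have "(c h + c h) / 2 \<le> 1 / (2 * (p * (1 - p)) * sqrt h)"
    using sum_sq_binom_weight_le[OF p h(1)] by (simp add: c_def)
  also have "\<dots> \<le> 1 / (p * (1 - p) * sqrt n)"
  proof -
    have "sqrt n \<le> sqrt (4 * h)"
      using h(3) by (metis of_nat_le_iff of_nat_mult of_nat_numeral real_sqrt_le_mono)
    also have "\<dots> = 2 * sqrt h"
      by (simp add: real_sqrt_mult)
    finally show ?thesis
      using p \<open>0 < n\<close> by (intro divide_left_mono mult_pos_pos) (auto simp: h)
  qed
  finally show ?thesis by simp
qed

section \<open>The random array and its information structure\<close>

locale splitting_array = prob_space M for M :: "'a measure" +
  fixes P :: "nat \<Rightarrow> nat \<Rightarrow> 'a \<Rightarrow> real" and p :: real
  assumes indep: "indep_vars (\<lambda>_. borel) (\<lambda>(n, k). P n k) {(n, k). 1 \<le> k \<and> k \<le> n}"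
    and ident: "\<And>n k. 1 \<le> k \<Longrightarrow> k \<le> n \<Longrightarrow> distr M borel (P n k) = distr M borel (P 1 1)"
    and range: "\<And>n k \<omega>. 1 \<le> k \<Longrightarrow> k \<le> n \<Longrightarrow> \<omega> \<in> space M \<Longrightarrow> P n k \<omega> \<in> {0..1}"
    and mean: "expectation (P 1 1) = p"
    and nondeg: "0 < measure M {\<omega> \<in> space M. P 1 1 \<omega> \<in> {0<..<1}}"
begin

definition index :: "(nat \<times> nat) set" where
  "index = {(n, k). 1 \<le> k \<and> k \<le> n}"

definition past :: "nat \<Rightarrow> (nat \<times> nat) set" where
  "past n = {(m, k) \<in> index. m \<le> n}"

text \<open>
  The sigma-algebra generated by the splitting proportions with indices in \<open>I\<close>.
\<close>

definition info :: "(nat \<times> nat) set \<Rightarrow> 'a measure" where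
  "info I = vimage_algebra (space M) (\<lambda>\<omega>. \<lambda>i\<in>I. (\<lambda>(n, k). P n k) i \<omega>) (\<Pi>\<^sub>M i\<in>I. borel)"

text \<open>
  The random variables on which all later expectations are taken. Boundedness gives integrability,
  and measurability with respect to \<open>info I\<close> gives independence from the proportions outside \<open>I\<close>;
  the class is closed under the operations that occur.
\<close>

definition bounded_in :: "(nat \<times> nat) set \<Rightarrow> ('a \<Rightarrow> real) \<Rightarrow> bool" where
  "bounded_in I Z \<longleftrightarrow> I \<subseteq> index \<and> Z \<in> borel_measurable (info I) \<and> (\<exists>C. \<forall>\<omega>\<in>space M. \<bar>Z \<omega>\<bar> \<le> C)"

lemma space_info [simp]: "space (info I) = space M"
  by (simp add: info_def)

lemma past_subset: "past n \<subseteq> index"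
  by (auto simp: past_def)

lemma in_index: "(n, k) \<in> index \<longleftrightarrow> 1 \<le> k \<and> k \<le> n"
  by (auto simp: index_def)

lemma measurable_P [measurable]: "(n, k) \<in> index \<Longrightarrow> P n k \<in> borel_measurable M"
  using indep unfolding indep_vars_def index_def by auto

lemma integrable_bounded_in:
  assumes "bounded_in I Z"
  shows "integrable M Z"
proof -
  obtain C where C: "\<And>\<omega>. \<omega> \<in> space M \<Longrightarrow> \<bar>Z \<omega>\<bar> \<le> C"
    using assms by (auto simp: bounded_in_def)
  have "(\<lambda>\<omega>. \<lambda>i\<in>I. (\<lambda>(n, k). P n k) i \<omega>) \<in> M \<rightarrow>\<^sub>M (\<Pi>\<^sub>M i\<in>I. borel)"
    using assms by (intro measurable_restrict) (auto simp: bounded_in_def)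
  then have "(\<lambda>\<omega>. \<omega>) \<in> M \<rightarrow>\<^sub>M info I"
    unfolding info_def by (intro measurable_vimage_algebra2) auto
  then have "Z \<in> borel_measurable M"
    using measurable_compose[of "\<lambda>\<omega>. \<omega>" M "info I" Z borel] assms by (auto simp: bounded_in_def)
  then show ?thesis
    using C by (intro integrable_const_bound[of _ C]) auto
qed

lemma bounded_in_const: "I \<subseteq> index \<Longrightarrow> bounded_in I (\<lambda>_. c)"
  by (auto simp: bounded_in_def)

lemma bounded_in_add:
  assumes "bounded_in I Y" "bounded_in I Z"
  shows "bounded_in I (\<lambda>\<omega>. Y \<omega> + Z \<omega>)"
proof -
  obtain C where "\<forall>\<omega>\<in>space M. \<bar>Y \<omega>\<bar> \<le> C"
    using assms(1) by (auto simp: bounded_in_def)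
  moreover obtain E where "\<forall>\<omega>\<in>space M. \<bar>Z \<omega>\<bar> \<le> E"
    using assms(2) by (auto simp: bounded_in_def)
  ultimately have "\<forall>\<omega>\<in>space M. \<bar>Y \<omega> + Z \<omega>\<bar> \<le> C + E"
    by (meson abs_triangle_ineq add_mono order_trans)
  then show ?thesis
    using assms unfolding bounded_in_def by (auto intro: borel_measurable_add)
qed

lemma bounded_in_mult:
  assumes "bounded_in I Y" "bounded_in I Z"
  shows "bounded_in I (\<lambda>\<omega>. Y \<omega> * Z \<omega>)"
proof -
  obtain C where "\<forall>\<omega>\<in>space M. \<bar>Y \<omega>\<bar> \<le> C"
    using assms(1) by (auto simp: bounded_in_def)
  moreover obtain E where "\<forall>\<omega>\<in>space M. \<bar>Z \<omega>\<bar> \<le> E"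
    using assms(2) by (auto simp: bounded_in_def)
  ultimately have "\<forall>\<omega>\<in>space M. \<bar>Y \<omega> * Z \<omega>\<bar> \<le> C * E"
    unfolding abs_mult by (meson abs_ge_zero mult_mono order_trans)
  then show ?thesis
    using assms unfolding bounded_in_def by (auto intro: borel_measurable_times)
qed

lemma bounded_in_diff: "bounded_in I Y \<Longrightarrow> bounded_in I Z \<Longrightarrow> bounded_in I (\<lambda>\<omega>. Y \<omega> - Z \<omega>)"
  using bounded_in_add[of I Y "\<lambda>\<omega>. -1 * Z \<omega>"] bounded_in_mult[of I "\<lambda>_. -1" Z] bounded_in_const[of I "-1"]
  by (auto simp: bounded_in_def)

lemma bounded_in_max_0:
  assumes "bounded_in I Z"
  shows "bounded_in I (\<lambda>\<omega>. max 0 (Z \<omega>))"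
proof -
  obtain C where C: "\<forall>\<omega>\<in>space M. \<bar>Z \<omega>\<bar> \<le> C"
    using assms by (auto simp: bounded_in_def)
  then have "\<forall>\<omega>\<in>space M. \<bar>max 0 (Z \<omega>)\<bar> \<le> C"
    by (auto simp: max_def abs_if intro: order_trans[OF abs_ge_zero])
  then show ?thesis
    using assms unfolding bounded_in_def by auto
qed

lemma bounded_in_P:
  assumes "(n, k) \<in> I" "I \<subseteq> index"
  shows "bounded_in I (P n k)"
proof -
  have "(\<lambda>\<omega>. \<lambda>i\<in>I. (\<lambda>(n, k). P n k) i \<omega>) \<in> info I \<rightarrow>\<^sub>M (\<Pi>\<^sub>M i\<in>I. borel)"
    unfolding info_def by (rule measurable_vimage_algebra1) (auto simp: space_PiM)
  from measurable_compose[OF this measurable_component_singleton[OF assms(1)]] assms(1)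
  have "P n k \<in> borel_measurable (info I)" by simp
  moreover have "\<forall>\<omega>\<in>space M. \<bar>P n k \<omega>\<bar> \<le> 1"
    using range[of k n] assms by (force simp: index_def)
  ultimately show ?thesis
    using assms(2) by (auto simp: bounded_in_def)
qed

definition A :: "nat \<Rightarrow> nat \<Rightarrow> 'a \<Rightarrow> real" where
  "A n k \<omega> = break_point (\<lambda>m j. P m j \<omega>) n k"

lemma A_0 [simp]: "A n 0 \<omega> = 0"
  by (simp add: A_def)

lemma A_beyond: "n < k \<Longrightarrow> A n k \<omega> = 1"
  by (simp add: A_def break_point_beyond)

lemma A_Suc_Suc:
  "A (Suc n) (Suc k) \<omega> = P (Suc n) (Suc k) \<omega> * A n k \<omega> + (1 - P (Suc n) (Suc k) \<omega>) * A n (Suc k) \<omega>"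
  by (simp add: A_def break_point_Suc_Suc)

lemma A_mono: "\<omega> \<in> space M \<Longrightarrow> k \<le> l \<Longrightarrow> A n k \<omega> \<le> A n l \<omega>"
  unfolding A_def by (intro break_point_mono range)

lemma A_range: "\<omega> \<in> space M \<Longrightarrow> A n k \<omega> \<in> {0..1}"
  unfolding A_def by (intro break_point_range range)

lemma bounded_in_A: "past n \<subseteq> I \<Longrightarrow> I \<subseteq> index \<Longrightarrow> bounded_in I (A n k)"
proof (induction n arbitrary: k)
  case 0
  have "A 0 k = (\<lambda>_. if k = 0 then 0 else 1)"
    by (auto simp: fun_eq_iff A_def)
  then show ?case
    using bounded_in_const[OF 0(2)] by simp
next
  case (Suc n)
  have IH: "bounded_in I (A n k)" for k
    using Suc by (intro Suc.IH) (auto simp: past_def)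
  consider "k = 0" | "Suc n < k" | j where "k = Suc j" "j \<le> n"
    by (metis Suc_le_mono not_less old.nat.exhaust)
  then show ?case
  proof cases
    case 1
    then have "A (Suc n) k = (\<lambda>_. 0)" by (simp add: fun_eq_iff)
    then show ?thesis using bounded_in_const[OF Suc.prems(2)] by simp
  next
    case 2
    then have "A (Suc n) k = (\<lambda>_. 1)" by (simp add: fun_eq_iff A_beyond)
    then show ?thesis using bounded_in_const[OF Suc.prems(2)] by simp
  next
    case 3
    then have "(Suc n, Suc j) \<in> I"
      using Suc.prems by (auto simp: past_def index_def)
    then show ?thesis
      unfolding 3 A_Suc_Suc[abs_def]
      by (intro bounded_in_add bounded_in_mult bounded_in_diff bounded_in_const bounded_in_P IH Suc.prems)
  qed
qed

lemmas bounded_in_intros =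
  bounded_in_const bounded_in_add bounded_in_mult bounded_in_diff bounded_in_max_0 bounded_in_P
  bounded_in_A

text \<open>
  The independence assumption in the form in which it is used: a single proportion is independent of
  everything generated by the others. Independence of the sigma-algebras generated by the two
  families passes to the smaller ones generated by the two factors.
\<close>

lemma expectation_mult_fresh:
  assumes nk: "(n, k) \<in> index" "(n, k) \<notin> I" and Z: "bounded_in I Z"
    and f: "f \<in> borel_measurable borel" "integrable M (\<lambda>\<omega>. f (P n k \<omega>))"
  shows "expectation (\<lambda>\<omega>. f (P n k \<omega>) * Z \<omega>) = expectation (\<lambda>\<omega>. f (P 1 1 \<omega>)) * expectation Z"
proof -
  let ?X = "\<lambda>J \<omega>. \<lambda>i\<in>J. (\<lambda>(n, k). P n k) i \<omega>"
  have I: "I \<subseteq> index" and Z_meas: "Z \<in> borel_measurable (info I)"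
    using Z by (auto simp: bounded_in_def)
  have "P n k \<in> borel_measurable (info {(n, k)})"
    using bounded_in_P[of n k "{(n, k)}"] nk by (auto simp: bounded_in_def)
  then have fP_meas: "(\<lambda>\<omega>. f (P n k \<omega>)) \<in> borel_measurable (info {(n, k)})"
    using f by measurable
  have rv: "random_variable borel Z" "random_variable borel (\<lambda>\<omega>. f (P n k \<omega>))"
    using integrable_bounded_in[OF Z] f(2) by auto
  have sub: "sigma_sets (space M) {Y -` A \<inter> space M |A. A \<in> sets borel} \<subseteq>
      sigma_sets (space M) {?X J -` A \<inter> space M |A. A \<in> sets (\<Pi>\<^sub>M i\<in>J. borel)}"
    if Y: "Y \<in> borel_measurable (info J)" for J and Y :: "'a \<Rightarrow> real"
  proof (rule sigma_sets_mono, safe)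
    fix B :: "real set" assume "B \<in> sets borel"
    then have "Y -` B \<inter> space (info J) \<in> sets (info J)"
      by (rule measurable_sets[OF Y])
    then show "Y -` B \<inter> space M \<in>
        sigma_sets (space M) {?X J -` A \<inter> space M |A. A \<in> sets (\<Pi>\<^sub>M i\<in>J. borel)}"
      unfolding space_info by (simp add: info_def sets_vimage_algebra)
  qed
  have "indep_var (\<Pi>\<^sub>M i\<in>{(n, k)}. borel) (?X {(n, k)}) (\<Pi>\<^sub>M i\<in>I. borel) (?X I)"
    using nk I by (intro indep_var_restrict[OF indep]) (auto simp: index_def)
  then have "indep_set
      (sigma_sets (space M) {?X {(n, k)} -` A \<inter> space M |A. A \<in> sets (\<Pi>\<^sub>M i\<in>{(n, k)}. borel)})
      (sigma_sets (space M) {?X I -` A \<inter> space M |A. A \<in> sets (\<Pi>\<^sub>M i\<in>I. borel)})"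
    unfolding indep_var_eq by blast
  then have "indep_set (sigma_sets (space M) {(\<lambda>\<omega>. f (P n k \<omega>)) -` A \<inter> space M |A. A \<in> sets borel})
      (sigma_sets (space M) {Z -` A \<inter> space M |A. A \<in> sets borel})"
    unfolding indep_set_def using sub[OF fP_meas] sub[OF Z_meas]
    by (rule_tac indep_sets_mono_sets) (auto split: bool.split)
  then have "indep_var borel (\<lambda>\<omega>. f (P n k \<omega>)) borel Z"
    unfolding indep_var_eq using rv by blast
  then have "expectation (\<lambda>\<omega>. f (P n k \<omega>) * Z \<omega>) = expectation (\<lambda>\<omega>. f (P n k \<omega>)) * expectation Z"
    by (rule indep_var_lebesgue_integral[OF _ f(2) integrable_bounded_in[OF Z]])
  also have "expectation (\<lambda>\<omega>. f (P n k \<omega>)) = integral\<^sup>L (distr M borel (P n k)) f"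
    using nk f by (subst integral_distr) auto
  also have "\<dots> = integral\<^sup>L (distr M borel (P 1 1)) f"
    using ident[of k n] nk by (simp add: in_index)
  also have "\<dots> = expectation (\<lambda>\<omega>. f (P 1 1 \<omega>))"
    using f by (subst integral_distr) (auto simp: in_index)
  finally show ?thesis .
qed

lemma expectation_mult_P:
  assumes "(n, k) \<in> index" "(n, k) \<notin> I" "bounded_in I Z"
  shows "expectation (\<lambda>\<omega>. P n k \<omega> * Z \<omega>) = p * expectation Z"
  using expectation_mult_fresh[OF assms, of "\<lambda>x. x"] mean assms(1)
    integrable_bounded_in[OF bounded_in_P[of n k index]] by auto

lemma expectation_mult_centred:
  assumes "(n, k) \<in> index" "(n, k) \<notin> I" "bounded_in I Z"
  shows "expectation (\<lambda>\<omega>. (P n k \<omega> - p) * Z \<omega>) = 0"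
proof -
  have int: "integrable M (P n k)" if "(n, k) \<in> index" for n k
    using that by (intro integrable_bounded_in[of index] bounded_in_P) auto
  have "expectation (\<lambda>\<omega>. P 1 1 \<omega> - p) = 0"
    using mean int[of 1 1] by (subst Bochner_Integration.integral_diff) (auto simp: in_index prob_space)
  then show ?thesis
    using expectation_mult_fresh[OF assms, of "\<lambda>x. x - p"] int[OF assms(1)] by auto
qed

definition p_var :: real where
  "p_var = variance (P 1 1)"

lemma expectation_mult_sq:
  assumes "(n, k) \<in> index" "(n, k) \<notin> I" "bounded_in I Z"
  shows "expectation (\<lambda>\<omega>. (P n k \<omega> - p)\<^sup>2 * Z \<omega>) = p_var * expectation Z"
proof -
  have "integrable M (\<lambda>\<omega>. (P n k \<omega> - p)\<^sup>2)"
    unfolding power2_eq_square using assms(1)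
    by (intro integrable_bounded_in[of index] bounded_in_intros) auto
  then show ?thesis
    using expectation_mult_fresh[OF assms, of "\<lambda>x. (x - p)\<^sup>2"] mean by (auto simp: p_var_def)
qed

section \<open>The covariance recursion\<close>

text \<open>
  The deviation of the break points from their means (\<open>expectation_D\<close>).
\<close>

definition D :: "nat \<Rightarrow> nat \<Rightarrow> 'a \<Rightarrow> real" where
  "D n k \<omega> = A n k \<omega> - binom_cdf p n k"

definition dev_cov :: "nat \<Rightarrow> nat \<Rightarrow> nat \<Rightarrow> real" where
  "dev_cov n k l = expectation (\<lambda>\<omega>. D n k \<omega> * D n l \<omega>)"

lemma dev_cov_commute: "dev_cov n k l = dev_cov n l k"
  by (simp add: dev_cov_def mult.commute)

lemma bounded_in_D: "past n \<subseteq> I \<Longrightarrow> I \<subseteq> index \<Longrightarrow> bounded_in I (D n k)"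
  unfolding D_def by (intro bounded_in_intros) auto

lemma D_0 [simp]: "D n 0 \<omega> = 0"
  by (simp add: D_def)

lemma D_beyond: "n < k \<Longrightarrow> D n k \<omega> = 0"
  by (simp add: D_def A_beyond break_point_beyond)

text \<open>
  The average of the old deviations plus a term that is centred given the past. The factor of
  \<open>P - p\<close> is the difference \<open>A n k - A n (Suc k)\<close>, split into deviations and its mean, which is minus the
  binomial weight.
\<close>

lemma D_Suc_Suc:
  "D (Suc n) (Suc k) \<omega> = (p * D n k \<omega> + (1 - p) * D n (Suc k) \<omega>) +
     (P (Suc n) (Suc k) \<omega> - p) * (D n k \<omega> - D n (Suc k) \<omega> - binom_weight p n k)"
  by (simp add: D_def A_Suc_Suc break_point_Suc_Suc binom_weight_def algebra_simps)

lemma fresh_index: "k \<le> n \<Longrightarrow> (Suc n, Suc k) \<in> index" "(Suc n, Suc k) \<notin> past n"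
  by (auto simp: past_def index_def)

lemma expectation_D: "expectation (D n k) = 0"
proof (induction n arbitrary: k)
  case 0
  have "D 0 k = (\<lambda>_. 0)"
    by (cases k) (auto simp: D_beyond)
  then show ?case by simp
next
  case (Suc n)
  note bdd = bounded_in_intros bounded_in_D order_refl past_subset fresh_index
  consider "k = 0" | "Suc n < k" | j where "k = Suc j" "j \<le> n"
    by (metis Suc_le_mono not_less old.nat.exhaust)
  then show ?case
  proof cases
    case 1
    then have "D (Suc n) k = (\<lambda>_. 0)" by auto
    then show ?thesis by simp
  next
    case 2
    then have "D (Suc n) k = (\<lambda>_. 0)" by (auto simp: D_beyond)
    then show ?thesis by simp
  next
    case 3
    have "expectation (D (Suc n) (Suc j)) = expectation (\<lambda>\<omega>. p * D n j \<omega> + (1 - p) * D n (Suc j) \<omega>) +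
        expectation (\<lambda>\<omega>. (P (Suc n) (Suc j) \<omega> - p) * (D n j \<omega> - D n (Suc j) \<omega> - binom_weight p n j))"
      unfolding D_Suc_Suc[abs_def] using 3
      by (intro Bochner_Integration.integral_add integrable_bounded_in[of index] bdd)
    also have "expectation (\<lambda>\<omega>. (P (Suc n) (Suc j) \<omega> - p) * (D n j \<omega> - D n (Suc j) \<omega> - binom_weight p n j)) = 0"
      using 3 by (intro expectation_mult_centred[of _ _ "past n"] bdd)
    also have "expectation (\<lambda>\<omega>. p * D n j \<omega> + (1 - p) * D n (Suc j) \<omega>) = 
       expectation (\<lambda>\<omega>. p * D n j \<omega>) + expectation (\<lambda>\<omega>. (1 - p) * D n (Suc j) \<omega>)"
      by (intro Bochner_Integration.integral_add integrable_bounded_in[of index] bdd)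
    finally show ?thesis
      using 3 Suc by simp
  qed
qed

lemma expectation_avg_prod:
  "expectation (\<lambda>\<omega>. (p * D n k \<omega> + (1 - p) * D n (Suc k) \<omega>) * (p * D n l \<omega> + (1 - p) * D n (Suc l) \<omega>)) =
    p * p * dev_cov n k l + p * (1 - p) * dev_cov n k (Suc l) + p * (1 - p) * dev_cov n (Suc k) l +
    (1 - p) * (1 - p) * dev_cov n (Suc k) (Suc l)"
proof -
  have int: "integrable M (\<lambda>\<omega>. c * (D n i \<omega> * D n j \<omega>))" for i j c
    by (intro integrable_bounded_in[of index] bounded_in_intros bounded_in_D past_subset order_refl)
  have "(\<lambda>\<omega>. (p * D n k \<omega> + (1 - p) * D n (Suc k) \<omega>) * (p * D n l \<omega> + (1 - p) * D n (Suc l) \<omega>)) =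
    (\<lambda>\<omega>. p * p * (D n k \<omega> * D n l \<omega>) + p * (1 - p) * (D n k \<omega> * D n (Suc l) \<omega>) +
       p * (1 - p) * (D n (Suc k) \<omega> * D n l \<omega>) + (1 - p) * (1 - p) * (D n (Suc k) \<omega> * D n (Suc l) \<omega>))"
    by (auto simp: algebra_simps)
  then show ?thesis
    by (simp only: dev_cov_def Bochner_Integration.integral_add int Bochner_Integration.integrable_add
        integral_mult_right_zero)
qed

text \<open>
  At distinct sites the two fresh proportions are independent of each other and of the past, so every
  term that contains a centred factor vanishes: the two walks move independently.
\<close>

lemma dev_cov_step_distinct:
  assumes "k \<le> n" "l \<le> n" "k \<noteq> l"
  shows "dev_cov (Suc n) (Suc k) (Suc l) =
    p * p * dev_cov n k l + p * (1 - p) * dev_cov n k (Suc l) + p * (1 - p) * dev_cov n (Suc k) l +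
    (1 - p) * (1 - p) * dev_cov n (Suc k) (Suc l)"
proof -
  define W where "W k \<omega> = p * D n k \<omega> + (1 - p) * D n (Suc k) \<omega>" for k \<omega>
  define V where "V k \<omega> = D n k \<omega> - D n (Suc k) \<omega> - binom_weight p n k" for k \<omega>
  define \<xi> where "\<xi> k \<omega> = P (Suc n) (Suc k) \<omega> - p" for k \<omega>
  have W: "bounded_in I (W k)" and V: "bounded_in I (V k)" if "past n \<subseteq> I" "I \<subseteq> index" for I k
    unfolding W_def V_def by (intro bounded_in_intros bounded_in_D that)+
  have xi: "bounded_in I (\<xi> k)" if "(Suc n, Suc k) \<in> I" "I \<subseteq> index" for I k
    unfolding \<xi>_def by (intro bounded_in_intros that)
  note bdd = bounded_in_intros W V xi order_refl past_subset fresh_index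
  have cross: "expectation (\<lambda>\<omega>. \<xi> k \<omega> * (V k \<omega> * W l \<omega>)) = 0" if "k \<le> n" for k l
    unfolding \<xi>_def using that by (intro expectation_mult_centred[of _ _ "past n"] bdd)
  \<comment> \<open>The centred factor at k is independent of the past together with the proportion at l.\<close>
  have both: "expectation (\<lambda>\<omega>. \<xi> k \<omega> * (\<xi> l \<omega> * (V k \<omega> * V l \<omega>))) = 0"
    unfolding \<xi>_def[of k] using assms
    by (intro expectation_mult_centred[of _ _ "insert (Suc n, Suc l) (past n)"] bounded_in_mult W V xi)
      (auto simp: past_def in_index)
  have "(\<lambda>\<omega>. D (Suc n) (Suc k) \<omega> * D (Suc n) (Suc l) \<omega>) = (\<lambda>\<omega>. W k \<omega> * W l \<omega> +
      \<xi> k \<omega> * (V k \<omega> * W l \<omega>) + \<xi> l \<omega> * (V l \<omega> * W k \<omega>) + \<xi> k \<omega> * (\<xi> l \<omega> * (V k \<omega> * V l \<omega>)))"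
    unfolding D_Suc_Suc by (auto simp: W_def V_def \<xi>_def algebra_simps)
  moreover have "integrable M (\<lambda>\<omega>. W k \<omega> * W l \<omega>)" "integrable M (\<lambda>\<omega>. \<xi> k \<omega> * (V k \<omega> * W l \<omega>))"
    "integrable M (\<lambda>\<omega>. \<xi> l \<omega> * (V l \<omega> * W k \<omega>))" "integrable M (\<lambda>\<omega>. \<xi> k \<omega> * (\<xi> l \<omega> * (V k \<omega> * V l \<omega>)))"
    using assms by (intro integrable_bounded_in[of index] bdd; simp)+
  ultimately have "dev_cov (Suc n) (Suc k) (Suc l) = expectation (\<lambda>\<omega>. W k \<omega> * W l \<omega>)"
    using assms by (simp add: dev_cov_def cross both)
  then show ?thesis
    unfolding W_def expectation_avg_prod .
qed

text \<open>
  At a common site the squared centred factor survives. It changes the step probabilities of the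
  pair of walks, the probability of a step of their difference in a given direction becoming
  \<open>p * (1 - p) - p_var\<close>, and it adds the source term.
\<close>

lemma dev_cov_step_equal:
  assumes "k \<le> n"
  shows "dev_cov (Suc n) (Suc k) (Suc k) =
    (p * p + p_var) * dev_cov n k k + 2 * (p * (1 - p) - p_var) * dev_cov n k (Suc k) +
    ((1 - p) * (1 - p) + p_var) * dev_cov n (Suc k) (Suc k) + p_var * (binom_weight p n k)\<^sup>2"
proof -
  define W where "W \<omega> = p * D n k \<omega> + (1 - p) * D n (Suc k) \<omega>" for \<omega>
  define b where "b = binom_weight p n k"
  define V where "V \<omega> = D n k \<omega> - D n (Suc k) \<omega> - b" for \<omega>
  define \<xi> where "\<xi> \<omega> = P (Suc n) (Suc k) \<omega> - p" for \<omega>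
  have W: "bounded_in I W" and V: "bounded_in I V" if "past n \<subseteq> I" "I \<subseteq> index" for I
    unfolding W_def V_def by (intro bounded_in_intros bounded_in_D that)+
  have xi: "bounded_in I \<xi>" if "(Suc n, Suc k) \<in> I" "I \<subseteq> index" for I
    unfolding \<xi>_def by (intro bounded_in_intros that)
  note bdd = bounded_in_intros bounded_in_D W V xi order_refl past_subset fresh_index
  have cross: "expectation (\<lambda>\<omega>. \<xi> \<omega> * (2 * (V \<omega> * W \<omega>))) = 0"
    unfolding \<xi>_def using assms by (intro expectation_mult_centred[of _ _ "past n"] bdd)
  have sq: "expectation (\<lambda>\<omega>. (\<xi> \<omega>)\<^sup>2 * (V \<omega> * V \<omega>)) = p_var * expectation (\<lambda>\<omega>. V \<omega> * V \<omega>)"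
    unfolding \<xi>_def using assms by (intro expectation_mult_sq[of _ _ "past n"] bdd)
  have "(\<lambda>\<omega>. D (Suc n) (Suc k) \<omega> * D (Suc n) (Suc k) \<omega>) =
      (\<lambda>\<omega>. W \<omega> * W \<omega> + \<xi> \<omega> * (2 * (V \<omega> * W \<omega>)) + (\<xi> \<omega>)\<^sup>2 * (V \<omega> * V \<omega>))"
    unfolding D_Suc_Suc by (auto simp: W_def V_def \<xi>_def b_def power2_eq_square algebra_simps)
  moreover have "integrable M (\<lambda>\<omega>. W \<omega> * W \<omega>)" "integrable M (\<lambda>\<omega>. \<xi> \<omega> * (2 * (V \<omega> * W \<omega>)))"
    "integrable M (\<lambda>\<omega>. (\<xi> \<omega>)\<^sup>2 * (V \<omega> * V \<omega>))"
    unfolding power2_eq_square using assms by (intro integrable_bounded_in[of index] bdd; simp)+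
  ultimately have 1: "dev_cov (Suc n) (Suc k) (Suc k) =
      expectation (\<lambda>\<omega>. W \<omega> * W \<omega>) + p_var * expectation (\<lambda>\<omega>. V \<omega> * V \<omega>)"
    using sq by (simp add: dev_cov_def cross)
  have int: "integrable M (\<lambda>\<omega>. c * (D n i \<omega> * D n j \<omega>))" "integrable M (\<lambda>\<omega>. c * D n i \<omega>)" for i j c
    by (intro integrable_bounded_in[of index] bdd)+
  have "(\<lambda>\<omega>. V \<omega> * V \<omega>) = (\<lambda>\<omega>. 1 * (D n k \<omega> * D n k \<omega>) + (-2) * (D n k \<omega> * D n (Suc k) \<omega>) +
      1 * (D n (Suc k) \<omega> * D n (Suc k) \<omega>) + (-2 * b) * D n k \<omega> + (2 * b) * D n (Suc k) \<omega> + b * b)"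
    by (auto simp: V_def algebra_simps)
  then have "expectation (\<lambda>\<omega>. V \<omega> * V \<omega>) = 1 * dev_cov n k k + (-2) * dev_cov n k (Suc k) +
      1 * dev_cov n (Suc k) (Suc k) + (-2 * b) * expectation (D n k) + (2 * b) * expectation (D n (Suc k)) + b * b"
    by (simp only: dev_cov_def Bochner_Integration.integral_add int Bochner_Integration.integrable_add
        integral_mult_right_zero integrable_const lebesgue_integral_const prob_space) simp
  note 2 = this
  show ?thesis
    unfolding 1 2 unfolding W_def expectation_avg_prod expectation_D
    by (simp add: b_def power2_eq_square dev_cov_commute[of n "Suc k" k] algebra_simps)
qed

end

section \<open>Polynomial decay of the variances\<close>

context splitting_array
begin

text \<open>
  This is the mean of \<open>P * (1 - P)\<close>, the probability that two walks at the same site in the same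
  environment separate in a given direction.
\<close>

definition \<theta> :: real where
  "\<theta> = p * (1 - p) - p_var"

text \<open>
  This is where the proportions have to lie strictly between \<open>0\<close> and \<open>1\<close> with positive probability:
  otherwise two walks that have met stay together forever.
\<close>

lemma theta_pos: "0 < \<theta>"
proof -
  let ?Q = "\<lambda>\<omega>. P 1 1 \<omega> * (1 - P 1 1 \<omega>)"
  have bdd: "bounded_in index (P 1 1)"
    by (intro bounded_in_P) (auto simp: in_index)
  have int: "integrable M (P 1 1)" "integrable M (\<lambda>\<omega>. (P 1 1 \<omega>)\<^sup>2)" "integrable M ?Q"
    unfolding power2_eq_square
    by (intro integrable_bounded_in[of index] bounded_in_mult bounded_in_diff bounded_in_const bdd order_refl)+
  have "p_var = expectation (\<lambda>\<omega>. (P 1 1 \<omega>)\<^sup>2) - p\<^sup>2"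
    unfolding p_var_def by (subst variance_eq[OF int(1,2)]) (use mean in simp)
  moreover have "expectation ?Q = expectation (P 1 1) - expectation (\<lambda>\<omega>. (P 1 1 \<omega>)\<^sup>2)"
    using int(1,2) by (simp add: power2_eq_square algebra_simps)
  ultimately have eq: "\<theta> = expectation ?Q"
    using mean by (simp add: \<theta>_def power2_eq_square algebra_simps)
  have nonneg: "0 \<le> ?Q \<omega>" if "\<omega> \<in> space M" for \<omega>
    using range[of 1 1 \<omega>] that by auto
  then have "0 \<le> expectation ?Q"
    by (intro Bochner_Integration.integral_nonneg) auto
  moreover have "expectation ?Q \<noteq> 0"
  proof
    assume "expectation ?Q = 0"
    then have "AE \<omega> in M. ?Q \<omega> = 0"
      using integral_nonneg_eq_0_iff_AE[OF int(3)] nonneg by auto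
    then have "AE \<omega> in M. \<not> P 1 1 \<omega> \<in> {0<..<1}"
      by eventually_elim auto
    moreover have "P 1 1 \<in> borel_measurable M"
      using int(1) by auto
    then have "{\<omega> \<in> space M. P 1 1 \<omega> \<in> {0<..<1}} \<in> events"
      by measurable
    ultimately have "measure M {\<omega> \<in> space M. P 1 1 \<omega> \<in> {0<..<1}} = 0"
      by (subst prob_eq_0) auto
    then show False using nondeg by simp
  qed
  ultimately show ?thesis using eq by simp
qed

lemma p_var_nonneg: "0 \<le> p_var"
  by (simp add: p_var_def)

lemma p_in: "0 < p" "p < 1"
proof -
  have "0 < p * (1 - p)"
    using theta_pos p_var_nonneg by (simp add: \<theta>_def)
  then show "0 < p" "p < 1"
    by (auto simp: zero_less_mult_iff)
qed

lemma p_spread: "p * (1 - p) \<le> 1/4"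
proof -
  have "p * (1 - p) = 1/4 - (p - 1/2)\<^sup>2"
    by (simp add: power2_eq_square algebra_simps)
  then show ?thesis
    using zero_le_power2[of "p - 1/2"] by linarith
qed

lemma p_var_le: "p_var \<le> p * (1 - p)"
  using theta_pos by (simp add: \<theta>_def)

lemma dev_cov_0 [simp]: "dev_cov n 0 l = 0" "dev_cov n k 0 = 0"
  by (simp_all add: dev_cov_def)

lemma dev_cov_beyond: "n < k \<or> n < l \<Longrightarrow> dev_cov n k l = 0"
  by (auto simp: dev_cov_def D_beyond)

lemma dev_cov_nonneg: "0 \<le> dev_cov n k k"
  by (simp add: dev_cov_def)

lemma dev_cov_le: "dev_cov n k l \<le> (dev_cov n k k + dev_cov n l l) / 2"
proof -
  have int: "integrable M (\<lambda>\<omega>. D n i \<omega> * D n j \<omega>)" for i j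
    by (intro integrable_bounded_in[of index] bounded_in_mult bounded_in_D past_subset order_refl)
  have "dev_cov n k l \<le> expectation (\<lambda>\<omega>. (D n k \<omega> * D n k \<omega> + D n l \<omega> * D n l \<omega>) / 2)"
    unfolding dev_cov_def
  proof (intro integral_mono)
    show "D n k \<omega> * D n l \<omega> \<le> (D n k \<omega> * D n k \<omega> + D n l \<omega> * D n l \<omega>) / 2" for \<omega>
      using sum_squares_bound[of "D n k \<omega>" "D n l \<omega>"] by (simp add: power2_eq_square)
  qed (use int in auto)
  also have "\<dots> = (dev_cov n k k + dev_cov n l l) / 2"
    using int by (simp add: dev_cov_def)
  finally show ?thesis .
qed

text \<open>
  On the diagonal the covariances are at most an average of the old variances plus the source term,
  and averaging keeps the sum over all sites. The sources at time \<open>n\<close> sum to \<open>O (1 / sqrt n)\<close>, because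
  the squared binomial weights do, and these bounds sum to \<open>O (sqrt n)\<close>.
\<close>

lemma sum_dev_cov_le: "(\<Sum>k\<le>n. dev_cov n k k) \<le> 2 * sqrt n"
proof (induction n)
  case 0
  show ?case by simp
next
  case (Suc n)
  define S where "S n = (\<Sum>k\<le>n. dev_cov n k k)" for n
  define c where "c = (\<Sum>k\<le>n. (binom_weight p n k)\<^sup>2)"
  have shift: "(\<Sum>k\<le>n. dev_cov n (Suc k) (Suc k)) = S n"
  proof -
    have "(\<Sum>k\<le>Suc n. dev_cov n k k) = S n"
      by (simp add: S_def dev_cov_beyond)
    then show ?thesis
      unfolding sum.atMost_Suc_shift by simp
  qed
  have "S (Suc n) = (\<Sum>k\<le>n. dev_cov (Suc n) (Suc k) (Suc k))"
    unfolding S_def sum.atMost_Suc_shift by simp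
  also have "\<dots> \<le> (\<Sum>k\<le>n. p * dev_cov n k k + (1 - p) * dev_cov n (Suc k) (Suc k) + p_var * (binom_weight p n k)\<^sup>2)"
  proof (rule sum_mono)
    fix k assume "k \<in> {..n}"
    then have "dev_cov (Suc n) (Suc k) (Suc k) = (p * p + p_var) * dev_cov n k k + 2 * \<theta> * dev_cov n k (Suc k) +
        ((1 - p) * (1 - p) + p_var) * dev_cov n (Suc k) (Suc k) + p_var * (binom_weight p n k)\<^sup>2"
      using dev_cov_step_equal[of k n] by (simp add: \<theta>_def)
    also have "2 * \<theta> * dev_cov n k (Suc k) \<le> 2 * \<theta> * ((dev_cov n k k + dev_cov n (Suc k) (Suc k)) / 2)"
      using theta_pos by (intro mult_left_mono dev_cov_le) auto
    also have "(p * p + p_var) * dev_cov n k k + 2 * \<theta> * ((dev_cov n k k + dev_cov n (Suc k) (Suc k)) / 2) +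
        ((1 - p) * (1 - p) + p_var) * dev_cov n (Suc k) (Suc k) + p_var * (binom_weight p n k)\<^sup>2 =
        p * dev_cov n k k + (1 - p) * dev_cov n (Suc k) (Suc k) + p_var * (binom_weight p n k)\<^sup>2"
      by (simp add: \<theta>_def field_simps)
    finally show "dev_cov (Suc n) (Suc k) (Suc k) \<le>
        p * dev_cov n k k + (1 - p) * dev_cov n (Suc k) (Suc k) + p_var * (binom_weight p n k)\<^sup>2"
      by simp
  qed
  also have "\<dots> = p * S n + (1 - p) * (\<Sum>k\<le>n. dev_cov n (Suc k) (Suc k)) + p_var * c"
    unfolding S_def c_def by (simp only: sum.distrib sum_distrib_left)
  also have "\<dots> = S n + p_var * c"
    unfolding shift by (simp add: algebra_simps)
  finally have step: "S (Suc n) \<le> S n + p_var * c" .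
  show ?case
  proof (cases "n = 0")
    case True
    then have "p_var * c \<le> 1/4"
      using p_var_le p_spread by (simp add: c_def binom_weight_0)
    then show ?thesis
      using step Suc True by (simp add: S_def)
  next
    case False
    have "p_var * c \<le> (p * (1 - p)) * (1 / (2 * (p * (1 - p)) * sqrt n))"
      using False p_in p_var_le p_var_nonneg unfolding c_def
      by (intro mult_mono sum_sq_binom_weight_le) (auto intro: sum_nonneg)
    also have "\<dots> = 1 / (2 * sqrt n)"
      using p_in by simp
    also have "\<dots> \<le> 2 * sqrt (Suc n) - 2 * sqrt n"
    proof -
      have "sqrt (Suc n) \<le> sqrt (4 * n)"
        using False by (intro real_sqrt_le_mono) auto
      then have "sqrt (Suc n) \<le> 2 * sqrt n"
        by (simp add: real_sqrt_mult)
      moreover have "0 \<le> sqrt n"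
        by simp
      ultimately have le: "sqrt (Suc n) + sqrt n \<le> 4 * sqrt n"
        by linarith
      have "(sqrt (Suc n) - sqrt n) * (sqrt (Suc n) + sqrt n) = 1"
        by (simp add: algebra_simps)
      then have "sqrt (Suc n) - sqrt n = 1 / (sqrt (Suc n) + sqrt n)"
        using False by (subst eq_divide_eq) (auto simp: add_pos_pos)
      also have "\<dots> \<ge> 1 / (4 * sqrt n)"
        using le False by (intro divide_left_mono) (auto intro!: add_pos_pos mult_pos_pos)
      finally show ?thesis
        by (simp add: field_simps)
    qed
    finally show ?thesis
      using step Suc by (simp add: S_def)
  qed
qed

text \<open>
  The recursion is started at level \<open>L\<close>. Its initial data are replaced by half the sum of the variances
  at the two sites; since this is a sum of functions of a single site, each walk evolves it as a
  binomial walk, met or not. The sources after level \<open>L\<close> are at most a constant of order \<open>1 / L\<close>, so their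
  total is that constant times the expected number of collisions.
\<close>

lemma dev_cov_le_smooth_plus_sojourn:
  fixes L r k l :: nat
  assumes "0 < L"
  defines "R \<equiv> \<lambda>r. binom_smooth p r (\<lambda>j. dev_cov L j j)"
  shows "dev_cov (L + r) k l \<le>
    (R r k + R r l) / 2 + p_var / ((p * (1 - p))\<^sup>2 * L) * sojourn_bound \<theta> r (int k - int l)"
proof -
  define s where "s = p * (1 - p)"
  define B where "B = p_var / (s\<^sup>2 * L)"
  have s: "0 < s" "s \<le> 1/4" "\<theta> \<le> s"
    using p_in p_spread p_var_nonneg by (auto simp: s_def \<theta>_def)
  have B: "0 \<le> B"
    using p_var_nonneg by (simp add: B_def)
  have R: "0 \<le> R r k" for r k
    unfolding R_def binom_smooth_def using p_in
    by (intro sum_nonneg mult_nonneg_nonneg binom_weight_nonneg dev_cov_nonneg) auto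
  have R_Suc: "R (Suc r) (Suc k) = p * R r k + (1 - p) * R r (Suc k)" for r k
    by (simp add: R_def binom_smooth_Suc_Suc)
  have psi: "0 \<le> sojourn_bound \<theta> r d" for r d
    by (rule sojourn_bound_nonneg[OF theta_pos])
  have "dev_cov (L + r) k l \<le> (R r k + R r l) / 2 + B * sojourn_bound \<theta> r (int k - int l)"
  proof (induction r arbitrary: k l)
    case 0
    have "0 \<le> B * sojourn_bound \<theta> 0 (int k - int l)"
      using B psi by simp
    then show ?case
      using dev_cov_le[of L k l] unfolding R_def binom_smooth_0 add_0_right by linarith
  next
    case (Suc r)
    define n where "n = L + r"
    define \<psi> where "\<psi> = sojourn_bound \<theta> r"
    define d where "d = int k - int l"
    note IH = Suc[folded n_def \<psi>_def]
    show ?case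
    proof (cases "k = 0 \<or> l = 0 \<or> Suc n < k \<or> Suc n < l")
      case True
      then have "dev_cov (L + Suc r) k l = 0"
        by (auto simp: n_def intro: dev_cov_beyond)
      then show ?thesis
        using R[of "Suc r" k] R[of "Suc r" l] B psi[of "Suc r" "int k - int l"] by simp
    next
      case False
      then obtain k' l' where kl: "k = Suc k'" "l = Suc l'" "k' \<le> n" "l' \<le> n"
        by (metis Suc_le_mono not_less not0_implies_Suc)
      have d: "int k' - int l' = d" "int k' - int (Suc l') = d - 1" "int (Suc k') - int l' = d + 1"
        "int (Suc k') - int (Suc l') = d"
        by (auto simp: d_def kl)
      note IH' = IH[of k' l', unfolded d] IH[of k' "Suc l'", unfolded d] IH[of "Suc k'" l', unfolded d]
        IH[of "Suc k'" "Suc l'", unfolded d]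
      show ?thesis
      proof (cases "k' = l'")
        case False
        have "dev_cov (Suc n) k l = p * p * dev_cov n k' l' + s * dev_cov n k' (Suc l') +
            s * dev_cov n (Suc k') l' + (1 - p) * (1 - p) * dev_cov n (Suc k') (Suc l')"
          using dev_cov_step_distinct[of k' n l'] False kl by (simp add: s_def)
        also have "\<dots> \<le> p * p * ((R r k' + R r l') / 2 + B * \<psi> d) +
            s * ((R r k' + R r (Suc l')) / 2 + B * \<psi> (d - 1)) +
            s * ((R r (Suc k') + R r l') / 2 + B * \<psi> (d + 1)) +
            (1 - p) * (1 - p) * ((R r (Suc k') + R r (Suc l')) / 2 + B * \<psi> d)"
          using p_in s IH' by (intro add_mono mult_left_mono) auto
        also have "\<dots> = (R (Suc r) k + R (Suc r) l) / 2 +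
            B * (s * \<psi> (d - 1) + (1 - 2 * s) * \<psi> d + s * \<psi> (d + 1))"
          unfolding kl R_Suc s_def by (simp add: field_simps)
        also have "\<dots> \<le> (R (Suc r) k + R (Suc r) l) / 2 + B * sojourn_bound \<theta> (Suc r) d"
          using sojourn_bound_step[OF theta_pos, of s d r] s False B unfolding \<psi>_def
          by (intro add_left_mono mult_left_mono) (auto simp: d_def kl)
        finally show ?thesis
          by (simp add: n_def d_def)
      next
        case True
        then have d0: "d = 0" by (simp add: d_def kl)
        have even: "\<psi> (- 1) = \<psi> 1"
          by (simp add: \<psi>_def sojourn_bound_def)
        have b: "(binom_weight p n k')\<^sup>2 \<le> 1 / (s\<^sup>2 * L)"
        proof -
          have "binom_weight p n k' \<le> 1 / (s * sqrt n)"
            using binom_weight_le[of p n k'] p_in \<open>0 < L\<close> by (simp add: s_def n_def)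
          also have "\<dots> \<le> 1 / (s * sqrt L)"
            using s \<open>0 < L\<close> by (intro divide_left_mono mult_left_mono mult_pos_pos) (auto simp: n_def)
          finally have "(binom_weight p n k')\<^sup>2 \<le> (1 / (s * sqrt L))\<^sup>2"
            using p_in by (intro power_mono binom_weight_nonneg) auto
          then show ?thesis by (simp add: power_divide power_mult_distrib)
        qed
        have "dev_cov (Suc n) k l = (p * p + p_var) * dev_cov n k' k' + 2 * \<theta> * dev_cov n k' (Suc k') +
            ((1 - p) * (1 - p) + p_var) * dev_cov n (Suc k') (Suc k') + p_var * (binom_weight p n k')\<^sup>2"
          using dev_cov_step_equal[of k' n] kl True by (simp add: \<theta>_def)
        also have "\<dots> \<le> (p * p + p_var) * ((R r k' + R r k') / 2 + B * \<psi> 0) +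
            2 * \<theta> * ((R r k' + R r (Suc k')) / 2 + B * \<psi> (- 1)) +
            ((1 - p) * (1 - p) + p_var) * ((R r (Suc k') + R r (Suc k')) / 2 + B * \<psi> 0) +
            p_var * (1 / (s\<^sup>2 * L))"
          using p_in p_var_nonneg theta_pos IH' b True d0 by (intro add_mono mult_left_mono) auto
        also have "\<dots> = (R (Suc r) k + R (Suc r) l) / 2 +
            B * (\<theta> * \<psi> (d - 1) + (1 - 2 * \<theta>) * \<psi> d + \<theta> * \<psi> (d + 1) + 1)"
        proof -
          have "p_var * (1 / (s\<^sup>2 * L)) = B"
            by (simp add: B_def)
          then show ?thesis
            unfolding kl R_Suc \<theta>_def d0 True[symmetric] by (simp add: even field_simps)
        qed
        also have "\<dots> \<le> (R (Suc r) k + R (Suc r) l) / 2 + B * sojourn_bound \<theta> (Suc r) d"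
          using sojourn_bound_step[OF theta_pos, of \<theta> d r] s theta_pos B d0 unfolding \<psi>_def
          by (intro add_left_mono mult_left_mono) auto
        finally show ?thesis
          by (simp add: n_def d_def)
      qed
    qed
  qed
  then show ?thesis
    by (simp add: B_def s_def)
qed

text \<open>
  The variances at level \<open>L\<close>, with sum at most \<open>2 * sqrt L\<close>, are averaged with binomial weights of
  size \<open>O (1 / sqrt r)\<close>.
\<close>

lemma dev_cov_decay:
  assumes "0 < L" "0 < r"
  shows "dev_cov (L + r) k k \<le> 2 * sqrt L / (p * (1 - p) * sqrt r) + sqrt r / (2 * \<theta> * (p * (1 - p)) * L)"
proof -
  define s where "s = p * (1 - p)"
  have s: "0 < s" using p_in by (simp add: s_def)
  have "(\<Sum>j\<le>k. binom_weight p r (k - j) * dev_cov L j j) \<le> (\<Sum>j\<le>k. 1 / (s * sqrt r) * dev_cov L j j)"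
    unfolding s_def using p_in \<open>0 < r\<close> by (intro sum_mono mult_right_mono binom_weight_le dev_cov_nonneg)
  also have "\<dots> = 1 / (s * sqrt r) * (\<Sum>j\<le>k. dev_cov L j j)"
    by (simp add: sum_distrib_left)
  also have "(\<Sum>j\<le>k. dev_cov L j j) \<le> (\<Sum>j\<le>k + L. dev_cov L j j)"
    by (intro sum_mono2) (auto simp: dev_cov_nonneg)
  also have "\<dots> = (\<Sum>j\<le>L. dev_cov L j j)"
    by (intro sum.mono_neutral_right) (auto simp: dev_cov_beyond)
  also have "\<dots> \<le> 2 * sqrt L"
    by (rule sum_dev_cov_le)
  finally have 1: "binom_smooth p r (\<lambda>j. dev_cov L j j) k \<le> 2 * sqrt L / (s * sqrt r)"
    using s by (simp add: binom_smooth_def divide_right_mono)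
  have "p_var / (s\<^sup>2 * L) * (sqrt r / (2 * \<theta>)) \<le> s / (s\<^sup>2 * L) * (sqrt r / (2 * \<theta>))"
    using p_var_le theta_pos by (intro mult_right_mono divide_right_mono) (auto simp: s_def)
  also have "\<dots> = sqrt r / (2 * \<theta> * s * L)"
    using s by (simp add: power2_eq_square)
  finally have 2: "p_var / (s\<^sup>2 * L) * (sqrt r / (2 * \<theta>)) \<le> sqrt r / (2 * \<theta> * s * L)" .
  show ?thesis
    using dev_cov_le_smooth_plus_sojourn[OF \<open>0 < L\<close>, of r k k] 1 2
    by (simp add: sojourn_bound_at_0 s_def)
qed

end

section \<open>Exponential control over many steps\<close>

lemma exp_minus_le:
  fixes x :: real
  assumes "\<bar>x\<bar> \<le> 1"
  shows "exp (- x) \<le> 1 - x + x\<^sup>2"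
proof (cases "0 \<le> x")
  case True
  have "1 = exp (- x) * exp x"
    by (simp flip: exp_add)
  also have "\<dots> \<ge> exp (- x) * (1 + x)"
    by (intro mult_left_mono exp_ge_add_one_self) auto
  finally have "exp (- x) * (1 + x) \<le> 1" .
  also have "1 \<le> (1 - x + x\<^sup>2) * (1 + x)"
    using True by (simp add: power2_eq_square algebra_simps)
  finally show ?thesis
    using True by (auto dest: mult_right_le_imp_le)
next
  case False
  then show ?thesis
    using exp_bound[of "- x"] assms by simp
qed

context splitting_array
begin

text \<open>
  For \<open>\<sigma> = 1\<close>: the expected amount by which the break point with index \<open>k\<close>, \<open>r\<close> steps later, exceeds the
  present one with index \<open>j\<close>. It is at most the probability that the binomial walk from \<open>k\<close> is above \<open>j\<close>
  after \<open>r\<close> steps, and the claim is the exponential Markov inequality for it. For \<open>\<sigma> = -1\<close> the same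
  holds for the shortfall and the event of being below \<open>j\<close>. As the positive part is convex, the
  excess is at most the average, over one step of the walk, of the excesses one time unit earlier.
\<close>

lemma expectation_excess_le:
  fixes \<sigma> \<eta> :: real
  assumes \<sigma>: "\<sigma> = 1 \<or> \<sigma> = -1" and \<eta>: "0 \<le> \<eta>" "\<eta> \<le> 1"
  shows "expectation (\<lambda>\<omega>. max 0 (\<sigma> * (A (m + r) k \<omega> - A m j \<omega>))) \<le>
    exp (\<eta> * \<sigma> * (real k - real j - p * r) + \<eta>\<^sup>2 * r)"
proof -
  define Z where "Z r k \<omega> = max 0 (\<sigma> * (A (m + r) k \<omega> - A m j \<omega>))" for r k \<omega>
  define x where "x = \<eta> * \<sigma>"
  define g where "g = p * exp (- x) + (1 - p)"
  have Z_bdd: "bounded_in I (Z r k)" if "past (m + r) \<subseteq> I" "I \<subseteq> index" for I r k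
    unfolding Z_def using that
    by (intro bounded_in_intros) (auto simp: past_def)
  have int: "integrable M (Z r k)" for r k
    by (intro integrable_bounded_in[of index] Z_bdd past_subset order_refl)
  have Z_le: "Z r k \<omega> \<le> 1" if "\<omega> \<in> space M" for r k \<omega>
    using A_range[OF that, of "m + r" k] A_range[OF that, of m j] \<sigma> by (auto simp: Z_def)
  have le_1: "expectation (Z r k) \<le> 1" for r k
  proof -
    have "expectation (Z r k) \<le> expectation (\<lambda>_. 1)"
      by (intro integral_mono int) (auto simp: Z_le)
    then show ?thesis by (simp add: prob_space)
  qed
  have g: "0 < g"
    using p_in by (auto simp: g_def intro!: add_pos_pos)
  have step: "expectation (Z (Suc r) (Suc k)) \<le> p * expectation (Z r k) + (1 - p) * expectation (Z r (Suc k))" for r k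
  proof (cases "k \<le> m + r")
    case True
    let ?P = "P (Suc (m + r)) (Suc k)"
    have idx: "(Suc (m + r), Suc k) \<in> index" "(Suc (m + r), Suc k) \<notin> past (m + r)"
      using True by (auto simp: past_def in_index)
    have "bounded_in index (\<lambda>\<omega>. ?P \<omega> * (Z r k \<omega> - Z r (Suc k) \<omega>))"
      using idx by (intro bounded_in_intros Z_bdd past_subset order_refl)
    then have intP: "integrable M (\<lambda>\<omega>. ?P \<omega> * (Z r k \<omega> - Z r (Suc k) \<omega>))"
      by (rule integrable_bounded_in)
    have "expectation (Z (Suc r) (Suc k)) \<le> expectation (\<lambda>\<omega>. ?P \<omega> * (Z r k \<omega> - Z r (Suc k) \<omega>) + Z r (Suc k) \<omega>)"
    proof (intro integral_mono)
      fix \<omega> assume \<omega>: "\<omega> \<in> space M"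
      define a b c where "a = A (m + r) k \<omega>" and "b = A (m + r) (Suc k) \<omega>" and "c = A m j \<omega>"
      have P: "0 \<le> ?P \<omega>" "?P \<omega> \<le> 1"
        using range[of "Suc k" "Suc (m + r)" \<omega>] \<omega> True by auto
      have "Z (Suc r) (Suc k) \<omega> = max 0 (?P \<omega> * (\<sigma> * (a - c)) + (1 - ?P \<omega>) * (\<sigma> * (b - c)))"
        by (simp add: Z_def A_Suc_Suc a_def b_def c_def algebra_simps)
      also have "\<dots> \<le> ?P \<omega> * max 0 (\<sigma> * (a - c)) + (1 - ?P \<omega>) * max 0 (\<sigma> * (b - c))"
        using P by (intro max.boundedI add_mono mult_left_mono add_nonneg_nonneg mult_nonneg_nonneg) auto
      also have "\<dots> = ?P \<omega> * (Z r k \<omega> - Z r (Suc k) \<omega>) + Z r (Suc k) \<omega>"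
        by (simp add: Z_def a_def b_def c_def algebra_simps)
      finally show "Z (Suc r) (Suc k) \<omega> \<le> ?P \<omega> * (Z r k \<omega> - Z r (Suc k) \<omega>) + Z r (Suc k) \<omega>" .
    qed (use int intP in auto)
    also have "\<dots> = expectation (\<lambda>\<omega>. ?P \<omega> * (Z r k \<omega> - Z r (Suc k) \<omega>)) + expectation (Z r (Suc k))"
      by (rule Bochner_Integration.integral_add[OF intP int])
    also have "expectation (\<lambda>\<omega>. ?P \<omega> * (Z r k \<omega> - Z r (Suc k) \<omega>)) =
        p * expectation (\<lambda>\<omega>. Z r k \<omega> - Z r (Suc k) \<omega>)"
      using idx by (intro expectation_mult_P[of _ _ "past (m + r)"] bounded_in_diff Z_bdd past_subset order_refl)
    also have "expectation (\<lambda>\<omega>. Z r k \<omega> - Z r (Suc k) \<omega>) = expectation (Z r k) - expectation (Z r (Suc k))"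
      by (rule Bochner_Integration.integral_diff[OF int int])
    finally show ?thesis
      by (simp add: algebra_simps)
  next
    case False
    then have "Z (Suc r) (Suc k) = Z r k" "Z r (Suc k) = Z r k"
      by (auto simp: Z_def A_beyond)
    then show ?thesis
      by (simp add: algebra_simps)
  qed
  have "expectation (Z r k) \<le> exp (x * (real k - real j)) * g ^ r"
  proof (induction r arbitrary: k)
    case 0
    show ?case
    proof (cases "0 \<le> \<sigma> * (real k - real j)")
      case True
      then have "0 \<le> \<eta> * (\<sigma> * (real k - real j))"
        by (rule mult_nonneg_nonneg[OF \<eta>(1)])
      then have "1 \<le> exp (x * (real k - real j))"
        by (simp add: x_def mult.assoc)
      then have "expectation (Z 0 k) \<le> exp (x * (real k - real j))"
        using le_1[of 0 k] by linarith
      then show ?thesis by simp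
    next
      case False
      have "Z 0 k \<omega> = 0" if "\<omega> \<in> space M" for \<omega>
        using \<sigma> False A_mono[OF that, of k j m] A_mono[OF that, of j k m] by (auto simp: Z_def)
      then have "expectation (Z 0 k) = expectation (\<lambda>_. 0)"
        by (intro Bochner_Integration.integral_cong) auto
      then show ?thesis by simp
    qed
  next
    case (Suc r)
    show ?case
    proof (cases k)
      case 0
      show ?thesis
      proof (cases "\<sigma> = 1")
        case True
        have "Z (Suc r) k \<omega> = 0" if "\<omega> \<in> space M" for \<omega>
          using True A_range[OF that, of m j] 0 by (auto simp: Z_def)
        then have "expectation (Z (Suc r) k) = expectation (\<lambda>_. 0)"
          by (intro Bochner_Integration.integral_cong) auto
        then show ?thesis using g by simp
      next
        case False
        then have "\<sigma> = -1" using \<sigma> by simp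
        then have "1 \<le> exp (x * (real k - real j))" "1 \<le> exp (- x)"
          using 0 \<eta> by (auto simp: x_def)
        moreover have "1 \<le> g"
        proof -
          have "p * 1 \<le> p * exp (- x)"
            using \<open>1 \<le> exp (- x)\<close> p_in by (intro mult_left_mono) auto
          then show ?thesis by (simp add: g_def)
        qed
        ultimately have "1 * 1 \<le> exp (x * (real k - real j)) * g ^ Suc r"
          by (intro mult_mono one_le_power) auto
        then show ?thesis
          using le_1[of "Suc r" k] by linarith
      qed
    next
      case (Suc k')
      have "expectation (Z (Suc r) k) \<le> p * (exp (x * (real k' - real j)) * g ^ r) +
          (1 - p) * (exp (x * (real (Suc k') - real j)) * g ^ r)"
        unfolding Suc using step[of r k'] Suc.IH[of k'] Suc.IH[of "Suc k'"] p_in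
        by (smt (verit) mult_left_mono)
      also have "exp (x * (real k' - real j)) = exp (- x) * exp (x * (real (Suc k') - real j))"
        by (simp add: algebra_simps flip: exp_add)
      finally show ?thesis
        by (simp add: Suc g_def algebra_simps)
    qed
  qed
  also have "\<dots> \<le> exp (x * (real k - real j)) * exp (- (p * x) + x\<^sup>2) ^ r"
  proof (intro mult_left_mono power_mono)
    have "p * exp (- x) \<le> p * (1 - x + x\<^sup>2)"
      using \<sigma> \<eta> p_in by (intro mult_left_mono exp_minus_le) (auto simp: x_def)
    also have "\<dots> = p - p * x + p * x\<^sup>2"
      by (simp add: algebra_simps)
    also have "p * x\<^sup>2 \<le> 1 * x\<^sup>2"
      using p_in by (intro mult_right_mono) auto
    finally have "g \<le> 1 + (- (p * x) + x\<^sup>2)"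
      by (simp add: g_def)
    also have "\<dots> \<le> exp (- (p * x) + x\<^sup>2)"
      by (rule exp_ge_add_one_self)
    finally show "g \<le> exp (- (p * x) + x\<^sup>2)" .
  qed (use g in auto)
  also have "\<dots> = exp (\<eta> * \<sigma> * (real k - real j - p * r) + \<eta>\<^sup>2 * r)"
    using \<sigma> by (auto simp: x_def algebra_simps power2_eq_square simp flip: exp_add exp_of_nat_mult)
  finally show ?thesis
    unfolding Z_def[abs_def] .
qed

end

section \<open>The standard normal distribution function and its inverse\<close>

lemma continuous_on_std_normal_density: "continuous_on S std_normal_density"
  unfolding normal_density_def by (intro continuous_intros) auto

lemma std_normal_cdf_diff:
  assumes "a \<le> b"
  shows "std_normal_cdf b - std_normal_cdf a = integral {a..b} std_normal_density"
proof (cases "a = b")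
  case False
  interpret real_distribution std_normal_distribution
    by (rule real_dist_normal_dist)
  have int: "set_integrable lborel {a..b} std_normal_density"
    by (intro borel_integrable_atLeastAtMost' continuous_on_std_normal_density)
  have "emeasure std_normal_distribution {a<..b} =
      (\<integral>\<^sup>+x. ennreal (std_normal_density x) * indicator {a<..b} x \<partial>lborel)"
    by (rule emeasure_density) auto
  also have "\<dots> = (\<integral>\<^sup>+x. ennreal (indicator {a..b} x *\<^sub>R std_normal_density x) \<partial>lborel)"
    using AE_lborel_singleton[of a]
    by (intro nn_integral_cong_AE) (auto simp: indicator_def elim!: eventually_mono)
  also have "\<dots> = ennreal (LINT x:{a..b}|lborel. std_normal_density x)"
    unfolding set_lebesgue_integral_def using int
    by (intro nn_integral_eq_integral) (auto simp: set_integrable_def)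
  also have "(LINT x:{a..b}|lborel. std_normal_density x) = integral {a..b} std_normal_density"
    by (rule set_borel_integral_eq_integral[OF int])
  finally have "measure std_normal_distribution {a<..b} = integral {a..b} std_normal_density"
    by (simp add: measure_def integral_nonneg[OF integrable_continuous_real[OF continuous_on_std_normal_density]])
  then show ?thesis
    using assms False cdf_diff_eq[of a b] by (simp add: std_normal_cdf_def)
qed simp

lemma DERIV_std_normal_cdf: "(std_normal_cdf has_real_derivative std_normal_density x) (at x)"
proof -
  have "((\<lambda>u. integral {x - 1..u} std_normal_density) has_real_derivative std_normal_density x)
      (at x within {x - 1..x + 1})"
    by (rule integral_has_real_derivative) (auto intro: continuous_on_std_normal_density)
  then have "((\<lambda>u. std_normal_cdf (x - 1) + integral {x - 1..u} std_normal_density) has_real_derivative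
      std_normal_density x) (at x within {x - 1..x + 1})"
    by (auto intro!: derivative_eq_intros)
  then have "(std_normal_cdf has_real_derivative std_normal_density x) (at x within {x - 1..x + 1})"
    by (rule has_field_derivative_transform_within[where d = 1])
      (auto simp: std_normal_cdf_diff[symmetric])
  then show ?thesis
    by (simp add: at_within_Icc_at)
qed

lemma isCont_std_normal_cdf: "isCont std_normal_cdf x"
  by (rule DERIV_isCont[OF DERIV_std_normal_cdf])

lemma std_normal_cdf_strict_mono: "x < y \<Longrightarrow> std_normal_cdf x < std_normal_cdf y"
  by (rule DERIV_pos_imp_increasing)
    (auto intro!: exI DERIV_std_normal_cdf normal_density_pos)

lemma std_normal_cdf_less_iff: "std_normal_cdf x < std_normal_cdf y \<longleftrightarrow> x < y"
  by (metis std_normal_cdf_strict_mono less_asym linorder_neqE_linordered_idom)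

lemma std_normal_cdf_range: "0 < std_normal_cdf x" "std_normal_cdf x < 1"
proof -
  interpret real_distribution std_normal_distribution
    by (rule real_dist_normal_dist)
  show "0 < std_normal_cdf x"
    using std_normal_cdf_strict_mono[of "x - 1" x] cdf_nonneg[of "x - 1"]
    by (simp add: std_normal_cdf_def)
  show "std_normal_cdf x < 1"
    using std_normal_cdf_strict_mono[of x "x + 1"] cdf_bounded_prob[of "x + 1"]
    by (simp add: std_normal_cdf_def)
qed

lemma std_normal_cdf_quantile:
  assumes "0 < u" "u < 1"
  shows "std_normal_cdf (std_normal_quantile u) = u"
proof -
  interpret real_distribution std_normal_distribution
    by (rule real_dist_normal_dist)
  have "\<forall>\<^sub>F x in at_bot. std_normal_cdf x < u" "\<forall>\<^sub>F x in at_top. u < std_normal_cdf x"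
    using order_tendstoD(2)[OF cdf_lim_at_bot assms(1)] order_tendstoD(1)[OF cdf_lim_at_top_prob assms(2)]
    by (simp_all add: std_normal_cdf_def)
  then obtain a b where ab: "std_normal_cdf a < u" "u < std_normal_cdf b"
    using eventually_happens trivial_limit_at_bot_linorder trivial_limit_at_top_linorder by metis
  then have "a < b"
    by (metis less_trans std_normal_cdf_less_iff)
  then obtain x where "std_normal_cdf x = u"
    using IVT[of std_normal_cdf a u b] ab isCont_std_normal_cdf by force
  then show ?thesis
    unfolding std_normal_quantile_def by (intro f_inv_into_f) auto
qed

lemma std_normal_quantile_cdf: "std_normal_quantile (std_normal_cdf x) = x"
  unfolding std_normal_quantile_def
  by (rule inv_f_f) (metis injI less_irrefl linorder_neqE_linordered_idom std_normal_cdf_strict_mono)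

lemma DERIV_std_normal_quantile:
  assumes "0 < u" "u < 1"
  shows "(std_normal_quantile has_real_derivative
    inverse (std_normal_density (std_normal_quantile u))) (at u)"
proof (rule DERIV_inverse_function[where a = 0 and b = 1])
  show "(std_normal_cdf has_real_derivative std_normal_density (std_normal_quantile u))
      (at (std_normal_quantile u))"
    by (rule DERIV_std_normal_cdf)
  show "isCont std_normal_quantile u"
    using isCont_inverse_function[of 1 "std_normal_quantile u" std_normal_quantile std_normal_cdf]
      std_normal_cdf_quantile[OF assms] by (simp add: std_normal_quantile_cdf isCont_std_normal_cdf)
  show "std_normal_density (std_normal_quantile u) \<noteq> 0"
    using normal_density_pos[of 1 0] by (simp add: less_le)
qed (use assms std_normal_cdf_quantile in auto)

lemma deriv_std_normal_quantile:
  "0 < u \<Longrightarrow> u < 1 \<Longrightarrow> deriv std_normal_quantile u = inverse (std_normal_density (std_normal_quantile u))"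
  by (rule DERIV_imp_deriv[OF DERIV_std_normal_quantile])

lemma continuous_on_deriv_std_normal_quantile: "continuous_on {0<..<1} (deriv std_normal_quantile)"
proof -
  have "continuous_on {0<..<1} std_normal_quantile"
    using DERIV_std_normal_quantile
    by (auto intro!: continuous_at_imp_continuous_on DERIV_isCont)
  then have "continuous_on {0<..<1} (\<lambda>u. inverse (std_normal_density (std_normal_quantile u)))"
    using normal_density_pos[of 1 0]
    by (intro continuous_on_inverse continuous_on_compose2[OF continuous_on_std_normal_density[of UNIV]])
      (auto simp: less_le)
  then show ?thesis
    by (rule continuous_on_eq) (simp add: deriv_std_normal_quantile)
qed

section \<open>The central limit theorem for the binomial walk\<close>

text \<open>
  Conditioning on the last summand gives the defining recursion of the binomial distribution
  function.
\<close>

lemma (in prob_space) prob_sum_bernoulli_less: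
  fixes X :: "nat \<Rightarrow> 'a \<Rightarrow> real"
  assumes indep: "indep_vars (\<lambda>_. borel) X UNIV"
    and X01: "\<And>i \<omega>. X i \<omega> \<in> {0, 1}"
    and prob1: "\<And>i. prob {\<omega> \<in> space M. X i \<omega> = 1} = p"
  shows "prob {\<omega> \<in> space M. (\<Sum>i<n. X i \<omega>) < real k} = binom_cdf p n k"
proof (induction n arbitrary: k)
  case 0
  show ?case
    by (simp add: prob_space)
next
  case (Suc n)
  have [measurable]: "random_variable borel (X i)" for i
    using indep by (auto simp: indep_vars_def)
  define S where "S \<omega> = (\<Sum>i<n. X i \<omega>)" for \<omega>
  have S_nonneg: "0 \<le> S \<omega>" for \<omega>
    unfolding S_def using X01 by (intro sum_nonneg) (metis insertE order_refl singletonD zero_le_one)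
  show ?case
  proof (cases k)
    case 0
    have "{\<omega> \<in> space M. (\<Sum>i<Suc n. X i \<omega>) < real 0} = {}"
      using X01 by (auto simp: not_less intro!: sum_nonneg add_nonneg_nonneg)
        (metis insertE order_refl singletonD zero_le_one)+
    then show ?thesis
      using 0 by (simp only: measure_empty break_point_0)
  next
    case (Suc j)
    have ind: "indep_var borel (X n) borel (\<lambda>\<omega>. \<Sum>i<n. X i \<omega>)"
      by (rule indep_vars_sum) (use indep in \<open>auto intro: indep_vars_subset\<close>)
    have joint: "prob {\<omega> \<in> space M. X n \<omega> \<in> U \<and> S \<omega> \<in> {..<c}} =
        prob {\<omega> \<in> space M. X n \<omega> \<in> U} * prob {\<omega> \<in> space M. S \<omega> < c}"
      if "U \<in> sets borel" for U c
    proof -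
      have "prob ((\<lambda>\<omega>. (X n \<omega>, S \<omega>)) -` (U \<times> {..<c}) \<inter> space M) =
          prob (X n -` U \<inter> space M) * prob (S -` {..<c} \<inter> space M)"
        using ind that unfolding S_def by (intro indep_varD) auto
      also have "(\<lambda>\<omega>. (X n \<omega>, S \<omega>)) -` (U \<times> {..<c}) \<inter> space M = {\<omega> \<in> space M. X n \<omega> \<in> U \<and> S \<omega> \<in> {..<c}}"
        by auto
      also have "X n -` U \<inter> space M = {\<omega> \<in> space M. X n \<omega> \<in> U}"
        by auto
      also have "S -` {..<c} \<inter> space M = {\<omega> \<in> space M. S \<omega> < c}"
        by auto
      finally show ?thesis .
    qed
    have [measurable]: "random_variable borel S"
      unfolding S_def by measurable
    have "{\<omega> \<in> space M. X n \<omega> \<in> {0}} = space M - {\<omega> \<in> space M. X n \<omega> = 1}"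
      using X01[of n] by fastforce
    then have prob0: "prob {\<omega> \<in> space M. X n \<omega> \<in> {0}} = 1 - p"
      by (simp add: prob_compl prob1)
    have "(\<Sum>i<Suc n. X i \<omega>) < real k \<longleftrightarrow>
        X n \<omega> \<in> {1} \<and> S \<omega> \<in> {..<real j} \<or> X n \<omega> \<in> {0} \<and> S \<omega> \<in> {..<real (Suc j)}" for \<omega>
      using X01[of n \<omega>] by (auto simp: Suc S_def)
    then have "{\<omega> \<in> space M. (\<Sum>i<Suc n. X i \<omega>) < real k} =
        {\<omega> \<in> space M. X n \<omega> \<in> {1} \<and> S \<omega> \<in> {..<real j}} \<union>
        {\<omega> \<in> space M. X n \<omega> \<in> {0} \<and> S \<omega> \<in> {..<real (Suc j)}}"
      by blast
    then have "prob {\<omega> \<in> space M. (\<Sum>i<Suc n. X i \<omega>) < real k} =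
        prob {\<omega> \<in> space M. X n \<omega> \<in> {1} \<and> S \<omega> \<in> {..<real j}} +
        prob {\<omega> \<in> space M. X n \<omega> \<in> {0} \<and> S \<omega> \<in> {..<real (Suc j)}}"
      by (simp only:) (rule finite_measure_Union; auto)
    also have "\<dots> = p * binom_cdf p n j + (1 - p) * binom_cdf p n (Suc j)"
      unfolding joint[OF borel_singleton[OF sets.empty_sets]] prob0
      using Suc.IH[of j] Suc.IH[of "Suc j"] prob1[of n] by (simp add: S_def)
    finally show ?thesis
      by (simp add: Suc break_point_Suc_Suc)
  qed
qed

lemma (in prob_space) binom_cdf_tendsto_of_bernoulli:
  fixes X :: "nat \<Rightarrow> 'a \<Rightarrow> real"
  assumes indep: "indep_vars (\<lambda>_. borel) X UNIV"
    and X01: "\<And>i \<omega>. X i \<omega> \<in> {0, 1}"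
    and prob1: "\<And>i. prob {\<omega> \<in> space M. X i \<omega> = 1} = p"
    and distr: "\<And>i. distr M borel (X i) = \<mu>"
    and p: "0 < p" "p < 1"
  shows "(\<lambda>n. binom_cdf p n (nat (\<lfloor>real n * p + x * sqrt (real n * (p * (1 - p)))\<rfloor> + 1)))
    \<longlonglongrightarrow> std_normal_cdf x"
proof -
  define s where "s = p * (1 - p)"
  have s: "0 < s" using p by (simp add: s_def)
  have [measurable]: "random_variable borel (X i)" for i
    using indep by (auto simp: indep_vars_def)
  have abs: "\<bar>X i \<omega>\<bar> \<le> 1" and sq: "(X i \<omega>)\<^sup>2 = X i \<omega>" for i \<omega>
    using X01[of i \<omega>] by auto
  have int: "integrable M (X i)" for i
    by (rule integrable_const_bound[of _ 1]) (auto simp: abs)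
  have mean: "expectation (X i) = p" for i
  proof -
    have "X i \<omega> = indicator {\<omega> \<in> space M. X i \<omega> = 1} \<omega>" if "\<omega> \<in> space M" for \<omega>
      using X01[of i \<omega>] that by (auto simp: indicator_def)
    then have "expectation (X i) = expectation (indicator {\<omega> \<in> space M. X i \<omega> = 1})"
      by (rule Bochner_Integration.integral_cong[OF refl])
    then show ?thesis
      using prob1[of i] by simp
  qed
  have var: "variance (X i) = (sqrt s)\<^sup>2" for i
  proof -
    have "integrable M (\<lambda>\<omega>. (X i \<omega>)\<^sup>2)"
      unfolding sq by (rule int)
    from variance_eq[OF int this] show ?thesis
      unfolding sq mean using s by (simp add: s_def power2_eq_square algebra_simps)
  qed
  have "weak_conv_m (\<lambda>n. distr M borel (\<lambda>\<omega>. (\<Sum>i<n. X i \<omega> - p) / sqrt (real n * (sqrt s)\<^sup>2))) std_normal_distribution"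
    by (rule central_limit_theorem[where \<mu> = \<mu>]) (use indep mean s var distr int in \<open>auto simp: sq\<close>)
  moreover have "isCont (cdf std_normal_distribution) x"
    using isCont_std_normal_cdf[of x] by (simp add: std_normal_cdf_def)
  ultimately have lim: "(\<lambda>n. cdf (distr M borel (\<lambda>\<omega>. (\<Sum>i<n. X i \<omega> - p) / sqrt (real n * (sqrt s)\<^sup>2))) x)
      \<longlonglongrightarrow> std_normal_cdf x"
    by (auto simp: weak_conv_m_def weak_conv_def std_normal_cdf_def)
  have eq: "cdf (distr M borel (\<lambda>\<omega>. (\<Sum>i<n. X i \<omega> - p) / sqrt (real n * (sqrt s)\<^sup>2))) x =
      binom_cdf p n (nat (\<lfloor>real n * p + x * sqrt (real n * s)\<rfloor> + 1))" if "0 < n" for n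
  proof -
    have iff: "(\<Sum>i<n. X i \<omega> - p) / sqrt (real n * (sqrt s)\<^sup>2) \<le> x \<longleftrightarrow>
        (\<Sum>i<n. X i \<omega>) < real (nat (\<lfloor>real n * p + x * sqrt (real n * s)\<rfloor> + 1))" for \<omega>
    proof -
      have "\<exists>N. (\<Sum>i<m. X i \<omega>) = real N" for m
      proof (induction m)
        case (Suc m)
        then obtain N where "(\<Sum>i<m. X i \<omega>) = real N" by blast
        then have "(\<Sum>i<Suc m. X i \<omega>) = real (if X m \<omega> = 0 then N else Suc N)"
          using X01[of m \<omega>] by auto
        then show ?case by blast
      qed (auto intro: exI[of _ 0])
      then obtain N where N: "(\<Sum>i<n. X i \<omega>) = real N" by blast
      have "(\<Sum>i<n. X i \<omega> - p) / sqrt (real n * (sqrt s)\<^sup>2) \<le> x \<longleftrightarrow>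
          real N \<le> real n * p + x * sqrt (real n * s)"
        using that s by (simp add: sum_subtractf N pos_divide_le_eq algebra_simps)
      also have "\<dots> \<longleftrightarrow> int N \<le> \<lfloor>real n * p + x * sqrt (real n * s)\<rfloor>"
        by (simp add: le_floor_iff)
      also have "\<dots> \<longleftrightarrow> N < nat (\<lfloor>real n * p + x * sqrt (real n * s)\<rfloor> + 1)"
        by auto
      finally show ?thesis by (simp add: N)
    qed
    have "cdf (distr M borel (\<lambda>\<omega>. (\<Sum>i<n. X i \<omega> - p) / sqrt (real n * (sqrt s)\<^sup>2))) x =
        prob {\<omega> \<in> space M. (\<Sum>i<n. X i \<omega> - p) / sqrt (real n * (sqrt s)\<^sup>2) \<le> x}"
      unfolding cdf_def by (subst measure_distr) (auto intro!: arg_cong[where f = prob])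
    then show ?thesis
      unfolding iff prob_sum_bernoulli_less[OF indep X01 prob1] .
  qed
  have "\<forall>\<^sub>F n in sequentially. cdf (distr M borel (\<lambda>\<omega>. (\<Sum>i<n. X i \<omega> - p) / sqrt (real n * (sqrt s)\<^sup>2))) x =
      binom_cdf p n (nat (\<lfloor>real n * p + x * sqrt (real n * s)\<rfloor> + 1))"
    using eventually_gt_at_top[of 0] by eventually_elim (rule eq)
  from Lim_transform_eventually[OF lim this] show ?thesis
    by (simp add: s_def)
qed

text \<open>
  No probability space is given here; an infinite product supplies one with a Bernoulli sequence.
\<close>

lemma binom_cdf_tendsto:
  assumes p: "0 < p" "p < 1"
  shows "(\<lambda>n. binom_cdf p n (nat (\<lfloor>real n * p + x * sqrt (real n * (p * (1 - p)))\<rfloor> + 1)))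
    \<longlonglongrightarrow> std_normal_cdf x"
proof -
  let ?B = "\<lambda>_ :: nat. measure_pmf (bernoulli_pmf p)"
  let ?C = "\<Pi>\<^sub>M i\<in>UNIV. ?B i"
  interpret B: prob_space "?B i" for i
    by (rule prob_space_measure_pmf)
  interpret C: product_prob_space ?B UNIV
    by unfold_locales
  have coord: "distr ?C (?B i) (\<lambda>\<omega>. \<omega> i) = ?B i" for i
    by (rule C.PiM_component) simp
  have "C.indep_vars ?B (\<lambda>i \<omega>. \<omega> i) UNIV"
    by (subst C.indep_vars_iff_distr_eq_PiM) (auto simp: coord restrict_UNIV distr_id)
  then have indep: "C.indep_vars (\<lambda>_. borel) (\<lambda>i \<omega>. of_bool (\<omega> i) :: real) UNIV"
    by (rule C.indep_vars_compose2[where Y = "\<lambda>_ b. of_bool b"]) auto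
  have distr: "distr ?C borel (\<lambda>\<omega>. of_bool (\<omega> i) :: real) = distr (bernoulli_pmf p) borel of_bool" for i
  proof -
    have "distr (bernoulli_pmf p) borel of_bool = distr (distr ?C (?B i) (\<lambda>\<omega>. \<omega> i)) borel (of_bool :: bool \<Rightarrow> real)"
      by (simp add: coord)
    also have "\<dots> = distr ?C borel (\<lambda>\<omega>. of_bool (\<omega> i) :: real)"
      by (subst distr_distr) (auto simp: comp_def)
    finally show ?thesis by simp
  qed
  have "measure ?C {\<omega> \<in> space ?C. (of_bool (\<omega> i) :: real) = 1} = p" for i
  proof -
    have "measure (?B i) {True} = measure (distr ?C (?B i) (\<lambda>\<omega>. \<omega> i)) {True}"
      by (simp add: coord)
    also have "\<dots> = measure ?C {\<omega> \<in> space ?C. (of_bool (\<omega> i) :: real) = 1}"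
      by (subst measure_distr) (auto intro!: arg_cong[where f = "measure ?C"])
    finally show ?thesis
      using p by (simp add: measure_pmf_single)
  qed
  then show ?thesis
    using p by (intro C.binom_cdf_tendsto_of_bernoulli[OF indep _ _ distr]) auto
qed

section \<open>Almost sure convergence of the break points\<close>

lemma (in prob_space) AE_tendsto_0_of_summable_expectation:
  fixes Z :: "nat \<Rightarrow> 'a \<Rightarrow> real"
  assumes int: "\<And>n. integrable M (Z n)" and nonneg: "\<And>n \<omega>. 0 \<le> Z n \<omega>"
    and summable: "summable (\<lambda>n. expectation (Z n))"
  shows "AE \<omega> in M. (\<lambda>n. Z n \<omega>) \<longlonglongrightarrow> 0"
proof -
  have [measurable]: "random_variable borel (Z n)" for n
    using int by auto
  have "(\<integral>\<^sup>+\<omega>. (\<Sum>n. ennreal (Z n \<omega>)) \<partial>M) = (\<Sum>n. \<integral>\<^sup>+\<omega>. ennreal (Z n \<omega>) \<partial>M)"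
    by (rule nn_integral_suminf) auto
  also have "\<dots> = (\<Sum>n. ennreal (expectation (Z n)))"
    by (intro suminf_cong nn_integral_eq_integral int) (auto simp: nonneg)
  also have "\<dots> \<noteq> \<infinity>"
    using summable nonneg by (subst suminf_ennreal2) auto
  finally have "AE \<omega> in M. (\<Sum>n. ennreal (Z n \<omega>)) \<noteq> \<infinity>"
    by (intro nn_integral_PInf_AE) auto
  then show ?thesis
  proof eventually_elim
    case (elim \<omega>)
    then have "summable (\<lambda>n. Z n \<omega>)"
      by (intro summable_suminf_not_top) (auto simp: nonneg)
    then show ?case by (rule summable_LIMSEQ_zero)
  qed
qed

lemma summable_exp_minus_root:
  fixes c :: real
  assumes "0 < c"
  shows "summable (\<lambda>n. exp (- c * (real n powr (1/12) - 1)))"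
proof (rule summable_comparison_test_bigo)
  show "(\<lambda>n. exp (- c * (real n powr (1/12) - 1))) \<in> O(\<lambda>n. real n powr (-2))"
    using assms by real_asymp
  show "summable (\<lambda>n. norm (real n powr (-2)))"
    by (simp add: summable_real_powr_iff)
qed

context splitting_array
begin

text \<open>
  The added \<open>1\<close> turns the strict inequality in \<open>binom_cdf\<close> into the weak one of a distribution function.
  Indices that would be negative are cut off at \<open>0\<close>, where the break point is \<open>0\<close>, as it should be.
\<close>

definition window :: "nat \<Rightarrow> real \<Rightarrow> nat" where
  "window n x = nat (\<lfloor>real n * p + x * sqrt (real n * (p * (1 - p)))\<rfloor> + 1)"

lemma window_mono: "x \<le> y \<Longrightarrow> window n x \<le> window n y"
  using p_in unfolding window_def
  by (intro nat_mono add_right_mono floor_mono add_left_mono mult_right_mono) auto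

text \<open>
  With \<open>n = i ^ 12\<close> and \<open>L = i ^ 8\<close> both terms of the variance bound are of order \<open>1 / i\<^sup>2\<close>.
\<close>

lemma AE_tendsto_at_block_starts:
  "AE \<omega> in M. (\<lambda>i. A (i ^ 12) (window (i ^ 12) x) \<omega>) \<longlonglongrightarrow> std_normal_cdf x"
proof -
  define Z where "Z i \<omega> = (D (i ^ 12) (window (i ^ 12) x) \<omega>)\<^sup>2" for i \<omega>
  define K where "K = 4 / (p * (1 - p)) + 1 / (2 * \<theta> * (p * (1 - p)))"
  have int: "integrable M (Z i)" for i
    unfolding Z_def power2_eq_square
    by (intro integrable_bounded_in[of index] bounded_in_mult bounded_in_D past_subset order_refl)
  have bound: "expectation (Z i) \<le> K * (1 / (real i)\<^sup>2)" if "2 \<le> i" for i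
  proof -
    define r where "r = i ^ 12 - i ^ 8"
    have "2 * i ^ 8 \<le> i ^ 4 * i ^ 8"
      using that power_mono[of 2 i 4] by (intro mult_right_mono) auto
    also have "\<dots> = i ^ 12" by (simp flip: power_add)
    finally have le: "2 * i ^ 8 \<le> i ^ 12" .
    have r: "0 < r" "i ^ 8 + r = i ^ 12" "i ^ 12 \<le> 4 * r" "r \<le> i ^ 12"
      using le that by (auto simp: r_def)
    have sq: "sqrt (real (i ^ 8)) = real i ^ 4" "sqrt (real (i ^ 12)) = real i ^ 6"
      by (rule real_sqrt_unique; simp flip: power_mult)+
    have "sqrt (real (i ^ 12)) \<le> sqrt (real (4 * r))"
      using r(3) by (subst real_sqrt_le_iff) (simp only: of_nat_le_iff)
    then have r_ge: "real i ^ 6 / 2 \<le> sqrt r"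
      unfolding sq by (simp add: real_sqrt_mult)
    have "sqrt (real r) \<le> sqrt (real (i ^ 12))"
      using r(4) by (subst real_sqrt_le_iff) (simp only: of_nat_le_iff)
    then have r_le: "sqrt r \<le> real i ^ 6"
      unfolding sq .
    have s: "0 < p * (1 - p)" using p_in by simp
    have i: "0 < real i" using that by simp
    have "expectation (Z i) = dev_cov (i ^ 8 + r) (window (i ^ 12) x) (window (i ^ 12) x)"
      unfolding r by (simp add: Z_def[abs_def] dev_cov_def power2_eq_square)
    also have "\<dots> \<le> 2 * sqrt (i ^ 8) / (p * (1 - p) * sqrt r) + sqrt r / (2 * \<theta> * (p * (1 - p)) * (i ^ 8))"
      using dev_cov_decay[of "i ^ 8" r "window (i ^ 12) x"] that r by simp
    also have "\<dots> \<le> 2 * real i ^ 4 / (p * (1 - p) * (real i ^ 6 / 2)) + real i ^ 6 / (2 * \<theta> * (p * (1 - p)) * (i ^ 8))"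
    proof (intro add_mono)
      have "p * (1 - p) * (real i ^ 6 / 2) \<le> p * (1 - p) * sqrt r"
        using r_ge s by (intro mult_left_mono) auto
      then show "2 * sqrt (i ^ 8) / (p * (1 - p) * sqrt r) \<le> 2 * real i ^ 4 / (p * (1 - p) * (real i ^ 6 / 2))"
        unfolding sq(1) using s p_in i r(1) by (intro divide_left_mono mult_pos_pos) auto
    qed (use r_le s theta_pos in \<open>auto intro: divide_right_mono\<close>)
    also have "\<dots> = K * (1 / (real i)\<^sup>2)"
      using i s theta_pos unfolding K_def by (simp add: divide_simps eval_nat_numeral)
    finally show ?thesis .
  qed
  have "summable (\<lambda>i. K * (1 / (real i)\<^sup>2))"
    using inverse_power_summable[of 2, where ?'a = real] by (intro summable_mult) (simp add: field_simps)
  then have "summable (\<lambda>i. expectation (Z i))"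
    by (rule summable_comparison_test_ev[rotated])
      (use bound in \<open>auto simp: Z_def eventually_sequentially intro!: exI[of _ 2] Bochner_Integration.integral_nonneg\<close>)
  then have "AE \<omega> in M. (\<lambda>i. Z i \<omega>) \<longlonglongrightarrow> 0"
    by (rule AE_tendsto_0_of_summable_expectation[OF int, rotated]) (simp add: Z_def)
  then show ?thesis
  proof eventually_elim
    case (elim \<omega>)
    then have "(\<lambda>i. sqrt (Z i \<omega>)) \<longlonglongrightarrow> sqrt 0"
      by (rule tendsto_real_sqrt)
    then have "(\<lambda>i. D (i ^ 12) (window (i ^ 12) x) \<omega>) \<longlonglongrightarrow> 0"
      by (simp add: Z_def tendsto_rabs_zero_iff)
    moreover have "(\<lambda>i. binom_cdf p (i ^ 12) (window (i ^ 12) x)) \<longlonglongrightarrow> std_normal_cdf x"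
    proof -
      have "filterlim (\<lambda>i::nat. i ^ 12) at_top at_top"
        by (rule filterlim_subseq) (auto simp: strict_mono_def intro: power_strict_mono)
      from filterlim_compose[OF binom_cdf_tendsto[OF p_in, of x] this]
      show ?thesis by (simp add: window_def)
    qed
    ultimately have "(\<lambda>i. D (i ^ 12) (window (i ^ 12) x) \<omega> + binom_cdf p (i ^ 12) (window (i ^ 12) x))
        \<longlonglongrightarrow> 0 + std_normal_cdf x"
      by (rule tendsto_add)
    then show ?case by (simp add: D_def)
  qed
qed

text \<open>
  The number of the block \<open>{i ^ 12..<(i + 1) ^ 12}\<close> that contains \<open>n\<close>.
\<close>

definition block :: "nat \<Rightarrow> nat" where
  "block n = nat \<lfloor>real n powr (1/12)\<rfloor>"

lemma block_bounds: "block n ^ 12 \<le> n" "n < (block n + 1) ^ 12" "real n powr (1/12) - 1 \<le> block n"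
proof -
  define y where "y = real n powr (1/12)"
  have y: "0 \<le> y" "y ^ 12 = real n"
    by (auto simp: y_def powr_powr simp flip: powr_realpow' powr_numeral)
  have b: "real (block n) \<le> y" "y < real (block n) + 1"
    using y(1) by (auto simp: block_def y_def)
  have "real (block n) ^ 12 \<le> y ^ 12" "y ^ 12 < (real (block n) + 1) ^ 12"
    using b y(1) by (auto intro: power_mono power_strict_mono)
  then have "real (block n ^ 12) \<le> real n" "real n < real ((block n + 1) ^ 12)"
    by (simp_all add: y(2) add.commute)
  then show "block n ^ 12 \<le> n" "n < (block n + 1) ^ 12"
    by (simp_all only: of_nat_le_iff of_nat_less_iff)
  show "real n powr (1/12) - 1 \<le> block n"
    using b by (simp add: y_def)
qed

lemma filterlim_block: "filterlim block at_top at_top"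
proof -
  have "filterlim (\<lambda>n. nat \<lfloor>real n powr (1/12)\<rfloor>) at_top at_top"
    by real_asymp
  then show ?thesis by (simp add: block_def[abs_def])
qed

lemma power_gap:
  fixes i m :: nat
  assumes "1 \<le> i"
  shows "real ((i + 1) ^ Suc m) - real (i ^ Suc m) \<le> 2 ^ Suc m * real i ^ m"
proof (induction m)
  case 0
  show ?case by simp
next
  case (Suc m)
  have "real ((i + 1) ^ Suc (Suc m)) - real (i ^ Suc (Suc m)) =
      real i * (real ((i + 1) ^ Suc m) - real (i ^ Suc m)) + real (i + 1) ^ Suc m"
    by (simp add: algebra_simps)
  also have "\<dots> \<le> real i * (2 ^ Suc m * real i ^ m) + (2 * real i) ^ Suc m"
    using assms Suc by (intro add_mono mult_left_mono power_mono) auto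
  also have "\<dots> = 2 ^ Suc (Suc m) * real i ^ Suc m"
    by (simp add: power_mult_distrib)
  finally show ?case .
qed

lemma window_approx:
  "\<forall>\<^sub>F n in sequentially. real n * p + x * sqrt (real n * (p * (1 - p))) \<le> real (window n x) \<and>
     real (window n x) \<le> real n * p + x * sqrt (real n * (p * (1 - p))) + 1"
proof -
  have "\<forall>\<^sub>F n in sequentially. 0 \<le> real n * p + x * sqrt (real n * (p * (1 - p)))"
    using p_in by real_asymp
  then show ?thesis
  proof eventually_elim
    case (elim n)
    then have "real (window n x) = real_of_int \<lfloor>real n * p + x * sqrt (real n * (p * (1 - p)))\<rfloor> + 1"
      by (simp add: window_def)
    then show ?case by linarith
  qed
qed

text \<open>
  Let \<open>m = i ^ 12\<close> be the start of the block of \<open>n\<close> and \<open>r = n - m\<close>. The two window centres differ by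
  \<open>p * r\<close>, the mean displacement of the walk, plus a multiple of \<open>sqrt n - sqrt m = O (i ^ 5)\<close>, whereas
  shifting \<open>x\<close> by \<open>\<epsilon>\<close> moves the window by a multiple of \<open>sqrt m = i ^ 6\<close>. So the walk would have to
  deviate by order \<open>i ^ 6\<close> within \<open>r = O (i ^ 11)\<close> steps, and with \<open>\<eta>\<close> of order \<open>1 / i ^ 5\<close> the exponential
  bound is \<open>exp (- c * i)\<close>, which is summable over \<open>n\<close>.
\<close>

lemma AE_excess_over_block_start_tendsto_0:
  fixes \<sigma> \<epsilon> :: real
  assumes \<sigma>: "\<sigma> = 1 \<or> \<sigma> = -1" and "0 < \<epsilon>"
  shows "AE \<omega> in M. (\<lambda>n. max 0 (\<sigma> * (A n (window n x) \<omega> -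
    A (block n ^ 12) (window (block n ^ 12) (x + \<sigma> * \<epsilon>)) \<omega>))) \<longlonglongrightarrow> 0"
proof (rule AE_tendsto_0_of_summable_expectation)
  define s where "s = p * (1 - p)"
  have s: "0 < s" using p_in by (simp add: s_def)
  \<comment> \<open>The constant is so small that the quadratic term of the exponent, at most
    \<open>(\<kappa> / i ^ 5)\<^sup>2 * 2 ^ 12 * i ^ 11\<close>, takes up at most half of the linear one,
    \<open>(\<kappa> / i ^ 5) * (\<epsilon> * sqrt s / 2) * i ^ 6\<close>.\<close>
  define \<kappa> where "\<kappa> = min 1 (\<epsilon> * sqrt s / 2 ^ 14)"
  have \<kappa>: "0 < \<kappa>" "\<kappa> \<le> 1" "\<kappa> * 2 ^ 12 \<le> \<epsilon> * sqrt s / 4"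
    using s \<open>0 < \<epsilon>\<close> by (auto simp: \<kappa>_def)
  define c where "c = \<kappa> * (\<epsilon> * sqrt s / 4)"
  have c: "0 < c" using \<kappa> s \<open>0 < \<epsilon>\<close> by (simp add: c_def)
  let ?Z = "\<lambda>n \<omega>. max 0 (\<sigma> * (A n (window n x) \<omega> - A (block n ^ 12) (window (block n ^ 12) (x + \<sigma> * \<epsilon>)) \<omega>))"
  show int: "integrable M (?Z n)" for n
    by (intro integrable_bounded_in[of index] bounded_in_intros past_subset order_refl)
  show "0 \<le> ?Z n \<omega>" for n \<omega>
    by simp
  have block12: "filterlim (\<lambda>n. block n ^ 12) at_top at_top"
    by (rule filterlim_compose[OF _ filterlim_block])
      (rule filterlim_subseq, auto simp: strict_mono_def intro: power_strict_mono)
  have ev1: "\<forall>\<^sub>F i in sequentially. 1 \<le> i \<and>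
      \<bar>x\<bar> * sqrt s * (64 * real i ^ 5) + 1 \<le> \<epsilon> * sqrt s / 2 * real i ^ 6"
  proof (rule eventually_conj[OF eventually_ge_at_top])
    have "\<forall>\<^sub>F i in sequentially. a * (64 * real i ^ 5) + 1 \<le> b * real i ^ 6" if "0 < b" for a b :: real
      using that by real_asymp
    from this[of "\<epsilon> * sqrt s / 2" "\<bar>x\<bar> * sqrt s"] show "\<forall>\<^sub>F i in sequentially. \<bar>x\<bar> * sqrt s * (64 * real i ^ 5) + 1 \<le> \<epsilon> * sqrt s / 2 * real i ^ 6"
      using s \<open>0 < \<epsilon>\<close> by simp
  qed
  have "\<forall>\<^sub>F n in sequentially. norm (expectation (?Z n)) \<le> exp (- c * (real n powr (1/12) - 1))"
    using window_approx[of x] eventually_compose_filterlim[OF window_approx[of "x + \<sigma> * \<epsilon>"] block12]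
      eventually_compose_filterlim[OF ev1 filterlim_block]
  proof eventually_elim
    case (elim n)
    define i m r where "i = block n" and "m = i ^ 12" and "r = n - m"
    have i: "1 \<le> i" and i_large: "\<bar>x\<bar> * sqrt s * (64 * real i ^ 5) + 1 \<le> \<epsilon> * sqrt s / 2 * real i ^ 6"
      using elim(3) by (auto simp: i_def)
    have n: "n = m + r" "m \<le> n"
      using block_bounds(1)[of n] by (auto simp: r_def m_def i_def)
    have "real r = real n - real m"
      using n by simp
    also have "\<dots> \<le> real ((i + 1) ^ 12) - real (i ^ 12)"
      using block_bounds(2)[of n] unfolding m_def i_def by (intro diff_mono) (auto simp only: of_nat_le_iff)
    also have "\<dots> \<le> 2 ^ 12 * real i ^ 11"
      using power_gap[OF i, of 11] by (simp add: eval_nat_numeral)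
    finally have r: "real r \<le> 2 ^ 12 * real i ^ 11" .
    have sqrt_m: "sqrt (real m) = real i ^ 6"
      unfolding m_def by (rule real_sqrt_unique; simp flip: power_mult)
    have "sqrt (real n) \<le> sqrt (real ((i + 1) ^ 12))"
      using block_bounds(2)[of n] unfolding i_def by (subst real_sqrt_le_iff) (simp only: of_nat_le_iff)
    also have "\<dots> = real ((i + 1) ^ 6)"
      by (rule real_sqrt_unique; simp flip: power_mult)
    finally have "sqrt n - sqrt m \<le> real ((i + 1) ^ 6) - real (i ^ 6)"
      by (simp add: sqrt_m)
    also have "\<dots> \<le> 64 * real i ^ 5"
      using power_gap[OF i, of 5] by (simp add: eval_nat_numeral)
    finally have gap: "sqrt n - sqrt m \<le> 64 * real i ^ 5" .
    have gap0: "0 \<le> sqrt n - sqrt m"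
      using n by simp
    define k j where "k = window n x" and "j = window m (x + \<sigma> * \<epsilon>)"
    have kj: "real n * p + x * (sqrt n * sqrt s) \<le> k" "k \<le> real n * p + x * (sqrt n * sqrt s) + 1"
      "real m * p + (x + \<sigma> * \<epsilon>) * (sqrt m * sqrt s) \<le> j"
      "j \<le> real m * p + (x + \<sigma> * \<epsilon>) * (sqrt m * sqrt s) + 1"
      using elim(1,2) by (auto simp: k_def j_def m_def i_def s_def real_sqrt_mult)
    define w where "w = \<sigma> * x * sqrt s * (sqrt n - sqrt m)"
    have w: "w \<le> \<bar>x\<bar> * sqrt s * (64 * real i ^ 5)"
    proof -
      have "\<sigma> * x * sqrt s \<le> \<bar>x\<bar> * sqrt s"
        using \<sigma> s by (intro mult_right_mono) auto
      then have "w \<le> \<bar>x\<bar> * sqrt s * (sqrt n - sqrt m)"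
        unfolding w_def by (rule mult_right_mono[OF _ gap0])
      also have "\<dots> \<le> \<bar>x\<bar> * sqrt s * (64 * real i ^ 5)"
        using gap s by (intro mult_left_mono) auto
      finally show ?thesis .
    qed
    have "\<sigma> * (real k - real j - p * r) \<le> w - \<epsilon> * sqrt s * sqrt m + 1"
    proof -
      have pr: "p * real r = p * real n - p * real m"
        using n by (simp add: algebra_simps)
      define a b where "a = real n * p + x * (sqrt n * sqrt s)"
        and "b = real m * p + (x + \<sigma> * \<epsilon>) * (sqrt m * sqrt s)"
      have "\<sigma> * (real k - real j - p * r) \<le> \<sigma> * (a - b - p * r) + 1"
        using \<sigma> kj unfolding a_def[symmetric] b_def[symmetric] by auto
      also have "\<sigma> * (a - b - p * r) = w - \<epsilon> * sqrt s * sqrt m"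
        using \<sigma> unfolding pr by (auto simp: a_def b_def w_def algebra_simps)
      finally show ?thesis by simp
    qed
    also have "\<dots> \<le> - (\<epsilon> * sqrt s / 2 * real i ^ 6)"
      using w i_large sqrt_m by (simp add: algebra_simps)
    finally have shift: "\<sigma> * (real k - real j - p * r) \<le> - (\<epsilon> * sqrt s / 2 * real i ^ 6)" .
    define \<eta> where "\<eta> = \<kappa> / real i ^ 5"
    have \<eta>: "0 \<le> \<eta>" "\<eta> \<le> 1"
    proof -
      have "1 \<le> real i ^ 5" using i by (intro one_le_power) simp
      then show "0 \<le> \<eta>" "\<eta> \<le> 1"
        using \<kappa> by (auto simp: \<eta>_def divide_le_eq)
    qed
    have "expectation (?Z n) \<le> exp (\<eta> * \<sigma> * (real k - real j - p * r) + \<eta>\<^sup>2 * r)"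
    proof -
      have "?Z n = (\<lambda>\<omega>. max 0 (\<sigma> * (A (m + r) k \<omega> - A m j \<omega>)))"
        unfolding n(1)[symmetric] k_def j_def unfolding m_def i_def ..
      then show ?thesis
        using expectation_excess_le[OF \<sigma> \<eta>, of m r k j] by (simp only:)
    qed
    also have "\<dots> \<le> exp (- c * real i)"
    proof -
      have "\<eta> * \<sigma> * (real k - real j - p * r) \<le> \<eta> * (- (\<epsilon> * sqrt s / 2 * real i ^ 6))"
        unfolding mult.assoc[of \<eta> \<sigma>] by (rule mult_left_mono[OF shift \<eta>(1)])
      also have "\<dots> = - (2 * c * real i)"
        using i by (simp add: \<eta>_def c_def divide_simps eval_nat_numeral)
      finally have 1: "\<eta> * \<sigma> * (real k - real j - p * r) \<le> - (2 * c * real i)" .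
      have "\<eta>\<^sup>2 * r \<le> \<eta>\<^sup>2 * (2 ^ 12 * real i ^ 11)"
        using r by (intro mult_left_mono) auto
      also have "\<dots> = \<kappa> * (\<kappa> * 2 ^ 12) * real i"
        using i by (simp add: \<eta>_def divide_simps eval_nat_numeral)
      also have "\<dots> \<le> \<kappa> * (\<epsilon> * sqrt s / 4) * real i"
        using \<kappa> by (intro mult_right_mono mult_left_mono) auto
      finally have "\<eta>\<^sup>2 * r \<le> c * real i"
        by (simp add: c_def)
      with 1 show ?thesis by simp
    qed
    also have "\<dots> \<le> exp (- c * (real n powr (1/12) - 1))"
      using block_bounds(3)[of n] c by (simp add: i_def)
    finally show ?case
      by (simp add: abs_of_nonneg Bochner_Integration.integral_nonneg)
  qed
  then show "summable (\<lambda>n. expectation (?Z n))"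
    by (rule summable_comparison_test_ev[OF _ summable_exp_minus_root[OF c]])
qed

text \<open>
  The exceptional null sets are collected over rational \<open>x\<close> and \<open>\<epsilon>\<close>. For any other \<open>x\<close>, the break points
  are squeezed between those of rational neighbours, by monotonicity, and the limit is continuous.
\<close>

lemma AE_break_point_tendsto:
  "AE \<omega> in M. \<forall>x. (\<lambda>n. A n (window n x) \<omega>) \<longlonglongrightarrow> std_normal_cdf x"
proof -
  have "AE \<omega> in M. \<forall>x\<in>\<rat>. (\<lambda>i. A (i ^ 12) (window (i ^ 12) x) \<omega>) \<longlonglongrightarrow> std_normal_cdf x"
    by (subst AE_ball_countable) (auto intro: AE_tendsto_at_block_starts countable_rat)
  moreover have "AE \<omega> in M. \<forall>(x, \<epsilon>, \<sigma>)\<in>\<rat> \<times> (\<rat> \<inter> {0<..}) \<times> {1, -1}. (\<lambda>n. max 0 (\<sigma> * (A n (window n x) \<omega> -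
      A (block n ^ 12) (window (block n ^ 12) (x + \<sigma> * \<epsilon>)) \<omega>))) \<longlonglongrightarrow> 0"
    by (subst AE_ball_countable)
      (auto intro!: AE_excess_over_block_start_tendsto_0[of 1, simplified] AE_excess_over_block_start_tendsto_0[of "-1", simplified]
        countable_SIGMA countable_Int1 countable_rat)
  moreover have "AE \<omega> in M. \<omega> \<in> space M"
    by (rule AE_space)
  ultimately show ?thesis
  proof eventually_elim
    case (elim \<omega>)
    have sparse: "(\<lambda>n. A (block n ^ 12) (window (block n ^ 12) x) \<omega>) \<longlonglongrightarrow> std_normal_cdf x" if "x \<in> \<rat>" for x
      using elim(1) that by (auto intro: filterlim_compose[OF _ filterlim_block])
    have excess: "(\<lambda>n. max 0 (\<sigma> * (A n (window n x) \<omega> - A (block n ^ 12) (window (block n ^ 12) (x + \<sigma> * \<epsilon>)) \<omega>))) \<longlonglongrightarrow> 0"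
      if "x \<in> \<rat>" "\<epsilon> \<in> \<rat>" "0 < \<epsilon>" "\<sigma> = 1 \<or> \<sigma> = -1" for x \<epsilon> \<sigma>
      using elim(2) that by auto
    \<comment> \<open>The sequence on the left bounds the break points in the windows of q from above if
      \<open>\<sigma> = 1\<close>, and from below if \<open>\<sigma> = -1\<close>.\<close>
    have lim: "(\<lambda>n. A (block n ^ 12) (window (block n ^ 12) (q + \<sigma> * \<epsilon>)) \<omega> +
        \<sigma> * max 0 (\<sigma> * (A n (window n q) \<omega> - A (block n ^ 12) (window (block n ^ 12) (q + \<sigma> * \<epsilon>)) \<omega>)))
        \<longlonglongrightarrow> std_normal_cdf (q + \<sigma> * \<epsilon>)"
      if "q \<in> \<rat>" "\<epsilon> \<in> \<rat>" "0 < \<epsilon>" "\<sigma> = 1 \<or> \<sigma> = -1" for q \<epsilon> \<sigma>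
    proof -
      have "q + \<sigma> * \<epsilon> \<in> \<rat>"
        using that by auto
      from tendsto_add[OF sparse[OF this] tendsto_mult[OF tendsto_const[of \<sigma>] excess[OF that]]]
      show ?thesis by simp
    qed
    show ?case
    proof (intro allI order_tendstoI)
      fix x a assume "std_normal_cdf x < a"
      then have "\<forall>\<^sub>F z in at x. std_normal_cdf z < a"
        using isCont_std_normal_cdf[of x] unfolding isCont_def by (rule order_tendstoD(2)[rotated])
      then obtain d where d: "0 < d" "\<And>z. z \<noteq> x \<Longrightarrow> dist z x < d \<Longrightarrow> std_normal_cdf z < a"
        unfolding eventually_at by auto
      obtain q where q: "q \<in> \<rat>" "x < q" "q < x + d / 2"
        using Rats_dense_in_real[of x "x + d / 2"] d by auto
      obtain \<epsilon> where e: "\<epsilon> \<in> \<rat>" "0 < \<epsilon>" "\<epsilon> < d / 2"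
        using Rats_dense_in_real[of 0 "d / 2"] d by auto
      have "std_normal_cdf (q + 1 * \<epsilon>) < a"
        using q e by (intro d) (auto simp: dist_real_def)
      from order_tendstoD(2)[OF lim[OF q(1) e(1,2), of 1] this]
      show "\<forall>\<^sub>F n in sequentially. A n (window n x) \<omega> < a"
      proof (rule eventually_mono, goal_cases)
        case (2 n)
        have "A n (window n x) \<omega> \<le> A n (window n q) \<omega>"
          using q elim(3) by (intro A_mono window_mono) auto
        then show ?case using 2 by simp
      qed simp
    next
      fix x a assume "a < std_normal_cdf x"
      then have "\<forall>\<^sub>F z in at x. a < std_normal_cdf z"
        using isCont_std_normal_cdf[of x] unfolding isCont_def by (rule order_tendstoD(1)[rotated])
      then obtain d where d: "0 < d" "\<And>z. z \<noteq> x \<Longrightarrow> dist z x < d \<Longrightarrow> a < std_normal_cdf z"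
        unfolding eventually_at by auto
      obtain q where q: "q \<in> \<rat>" "x - d / 2 < q" "q < x"
        using Rats_dense_in_real[of "x - d / 2" x] d by auto
      obtain \<epsilon> where e: "\<epsilon> \<in> \<rat>" "0 < \<epsilon>" "\<epsilon> < d / 2"
        using Rats_dense_in_real[of 0 "d / 2"] d by auto
      have "a < std_normal_cdf (q + (-1) * \<epsilon>)"
        using q e by (intro d) (auto simp: dist_real_def)
      from order_tendstoD(1)[OF lim[OF q(1) e(1,2), of "-1"] this]
      show "\<forall>\<^sub>F n in sequentially. a < A n (window n x) \<omega>"
      proof (rule eventually_mono, goal_cases)
        case (2 n)
        have "A n (window n q) \<omega> \<le> A n (window n x) \<omega>"
          using q elim(3) by (intro A_mono window_mono) auto
        then show ?case using 2 by simp
      qed simp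
    qed
  qed
qed

end

section \<open>From break points to vague convergence\<close>

text \<open>
  In this form the integral of a function reduces in three steps, restriction, density and image
  measure, to a finite sum.
\<close>

lemma scaled_break_empirical_eq:
  assumes "0 \<le> c"
  shows "scale_measure (ennreal c) (break_empirical P n) =
    restrict_space (density (distr (count_space {1..n}) borel (break_point P n)) (\<lambda>_. ennreal (c / n))) {0<..<1}"
proof (rule measure_eqI)
  fix B assume "B \<in> sets (scale_measure (ennreal c) (break_empirical P n))"
  then have B: "B \<in> sets borel" "B \<subseteq> {0<..<1}"
    by (auto simp: break_empirical_def sets_restrict_space)
  have "emeasure (distr (count_space {1..n}) borel (break_point P n)) B =
      (\<Sum>k=1..n. emeasure (return borel (break_point P n k)) B)"
  proof -
    have "emeasure (distr (count_space {1..n}) borel (break_point P n)) B =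
        of_nat (card (break_point P n -` B \<inter> {1..n}))"
      using B by (subst emeasure_distr) (auto simp: emeasure_count_space)
    also have "\<dots> = (\<Sum>k=1..n. indicator B (break_point P n k))"
      by (simp add: sum.If_cases indicator_def vimage_def Int_commute flip: Collect_conj_eq)
    finally show ?thesis using B by simp
  qed
  moreover have "emeasure (density (distr (count_space {1..n}) borel (break_point P n)) (\<lambda>_. ennreal (c / n))) B =
      ennreal (c / n) * emeasure (distr (count_space {1..n}) borel (break_point P n)) B"
    using B by (subst emeasure_density) (auto simp: nn_integral_cmult_indicator)
  moreover have "ennreal (c / n) = ennreal c * ennreal (1 / n)"
    using assms by (simp flip: ennreal_mult)
  ultimately show "emeasure (scale_measure (ennreal c) (break_empirical P n)) B =
      emeasure (restrict_space (density (distr (count_space {1..n}) borel (break_point P n)) (\<lambda>_. ennreal (c / n))) {0<..<1}) B"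
    using B by (simp add: break_empirical_def emeasure_restrict_space emeasure_empirical_measure mult.assoc)
qed (simp add: break_empirical_def sets_restrict_space)

lemma radon_scaled_break_empirical:
  "radon_on {0<..<1} (scale_measure (ennreal c) (break_empirical P n))"
proof -
  have "emeasure (scale_measure (ennreal c) (break_empirical P n)) B < \<infinity>" if "compact B" "B \<subseteq> {0<..<1}" for B
  proof -
    have B: "B \<in> sets borel" using that by (simp add: borel_compact)
    have "(\<Sum>k=1..n. emeasure (return borel (break_point P n k)) B) < \<top>"
      using B by (subst ennreal_sum_less_top) (auto simp: indicator_def)
    then show ?thesis
      using that B by (simp add: break_empirical_def emeasure_restrict_space emeasure_empirical_measure
          ennreal_mult_less_top)
  qed
  then show ?thesis
    by (simp add: radon_on_def break_empirical_def sets_restrict_space)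
qed

lemma integral_scaled_break_empirical:
  assumes "0 \<le> c" and f: "(\<lambda>u. indicator {0<..<1} u * f u) \<in> borel_measurable borel"
  shows "(\<integral>u. f u \<partial>(scale_measure (ennreal c) (break_empirical P n))) =
    c / n * (\<Sum>k=1..n. indicator {0<..<1} (break_point P n k) * f (break_point P n k))"
proof -
  let ?g = "\<lambda>u. indicator {0<..<1} u * f u"
  let ?N = "distr (count_space {1..n}) borel (break_point P n)"
  have "(\<integral>u. f u \<partial>(scale_measure (ennreal c) (break_empirical P n))) =
      (\<integral>u. ?g u \<partial>(density ?N (\<lambda>_. ennreal (c / n))))"
    unfolding scaled_break_empirical_eq[OF assms(1)]
    by (subst integral_restrict_space) auto
  also have "\<dots> = (\<integral>u. c / n * ?g u \<partial>?N)"
    using assms by (subst integral_real_density) auto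
  also have "\<dots> = (\<integral>k. c / n * ?g (break_point P n k) \<partial>count_space {1..n})"
    using f by (subst integral_distr) auto
  also have "\<dots> = c / n * (\<Sum>k=1..n. ?g (break_point P n k))"
    by (simp only: lebesgue_integral_count_space_finite[OF finite_atLeastAtMost] sum_distrib_left)
  finally show ?thesis .
qed

lemma deriv_std_normal_quantile_pos: "0 < u \<Longrightarrow> u < 1 \<Longrightarrow> 0 < deriv std_normal_quantile u"
  by (simp add: deriv_std_normal_quantile normal_density_pos)

lemma borel_measurable_continuous_on_unit:
  fixes f :: "real \<Rightarrow> real"
  assumes "continuous_on {0<..<1} f"
  shows "f \<in> borel_measurable (restrict_space lborel {0<..<1})"
    and "(\<lambda>u. indicator {0<..<1} u * f u) \<in> borel_measurable borel"
proof -
  have "f \<in> borel_measurable (restrict_space borel {0<..<1})"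
    by (rule borel_measurable_continuous_on_restrict[OF assms])
  then show "f \<in> borel_measurable (restrict_space lborel {0<..<1})"
    by (simp cong: measurable_cong_sets add: sets_restrict_space)
  show "(\<lambda>u. indicator {0<..<1} u * f u) \<in> borel_measurable borel"
    using borel_measurable_continuous_on_indicator[OF _ assms] by simp
qed

lemma radon_quantile_density:
  "radon_on {0<..<1} (density (restrict_space lborel {0<..<1}) (\<lambda>u. ennreal (deriv std_normal_quantile u)))"
proof -
  let ?Q' = "deriv std_normal_quantile"
  have meas: "?Q' \<in> borel_measurable (restrict_space lborel {0<..<1})"
    by (rule borel_measurable_continuous_on_unit(1)[OF continuous_on_deriv_std_normal_quantile])
  have "emeasure (density (restrict_space lborel {0<..<1}) (\<lambda>u. ennreal (?Q' u))) B < \<infinity>"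
    if B: "compact B" "B \<subseteq> {0<..<1}" for B
  proof -
    have Bs: "B \<in> sets (restrict_space lborel {0<..<1})"
      using B borel_compact[OF B(1)] by (auto simp: sets_restrict_space)
    have "compact (?Q' ` B)"
      using B by (intro compact_continuous_image continuous_on_subset[OF continuous_on_deriv_std_normal_quantile])
    then obtain C where C: "\<And>u. u \<in> B \<Longrightarrow> norm (?Q' u) \<le> C"
      using compact_imp_bounded bounded_iff by (metis imageI)
    have "emeasure (density (restrict_space lborel {0<..<1}) (\<lambda>u. ennreal (?Q' u))) B =
        (\<integral>\<^sup>+u. ennreal (?Q' u) * indicator B u \<partial>restrict_space lborel {0<..<1})"
      using meas Bs by (intro emeasure_density) auto
    also have "\<dots> \<le> (\<integral>\<^sup>+u. ennreal C * indicator B u \<partial>restrict_space lborel {0<..<1})"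
    proof (rule nn_integral_mono)
      fix u :: real
      show "ennreal (?Q' u) * indicator B u \<le> ennreal C * indicator B u"
        using C[of u] by (cases "u \<in> B") (auto intro: ennreal_leI)
    qed
    also have "\<dots> = ennreal C * emeasure lborel B"
      using Bs B by (simp add: nn_integral_cmult_indicator emeasure_restrict_space)
    also have "\<dots> < \<infinity>"
      using emeasure_compact_finite[OF B(1)] by (simp add: ennreal_mult_less_top)
    finally show ?thesis .
  qed
  then show ?thesis
    by (simp add: radon_on_def sets_restrict_space)
qed

text \<open>
  Substitution \<open>x = Q u\<close>. It is carried out on a compact interval that contains the support, where \<open>Q'\<close>
  is continuous.
\<close>

lemma integral_quantile_density:
  fixes g :: "real \<Rightarrow> real"
  assumes ab: "0 < a" "a \<le> b" "b < 1"
    and cont: "continuous_on {0<..<1} g"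
    and supp: "\<And>u. 0 < u \<Longrightarrow> u < 1 \<Longrightarrow> u \<notin> {a..b} \<Longrightarrow> g u = 0"
  shows "(\<integral>u. g u \<partial>(density (restrict_space lborel {0<..<1}) (\<lambda>u. ennreal (deriv std_normal_quantile u)))) =
    (\<integral>x. g (std_normal_cdf x) \<partial>lborel)"
proof -
  let ?Q = std_normal_quantile and ?Q' = "deriv std_normal_quantile"
  have unit: "u \<in> {0<..<1}" if "u \<in> {a..b}" for u
    using ab that by auto
  have QQ: "?Q a \<le> ?Q b"
    using std_normal_cdf_less_iff[of "?Q b" "?Q a"] std_normal_cdf_quantile ab by force
  have in_iff: "std_normal_cdf x \<in> {a..b} \<longleftrightarrow> x \<in> {?Q a..?Q b}" for x
    using std_normal_cdf_less_iff[of x "?Q a"] std_normal_cdf_less_iff[of "?Q b" x]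
      std_normal_cdf_quantile[of a] std_normal_cdf_quantile[of b] ab by (auto simp: not_less[symmetric])
  have "(\<integral>u. g u \<partial>(density (restrict_space lborel {0<..<1}) (\<lambda>u. ennreal (?Q' u)))) =
      (\<integral>u. ?Q' u * g u \<partial>(restrict_space lborel {0<..<1}))"
    using borel_measurable_continuous_on_unit(1)[OF cont]
      borel_measurable_continuous_on_unit(1)[OF continuous_on_deriv_std_normal_quantile]
    by (intro integral_real_density)
      (auto intro!: AE_I2 less_imp_le deriv_std_normal_quantile_pos simp: space_restrict_space)
  also have "\<dots> = (LBINT u. indicator {0<..<1} u *\<^sub>R (?Q' u * g u))"
    by (rule integral_restrict_space) simp
  also have "\<dots> = (LBINT u. g (std_normal_cdf (?Q u)) * ?Q' u * indicator {a..b} u)"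
  proof (rule Bochner_Integration.integral_cong[OF refl])
    fix u :: real
    show "indicator {0<..<1} u *\<^sub>R (?Q' u * g u) = g (std_normal_cdf (?Q u)) * ?Q' u * indicator {a..b} u"
      using supp[of u] unit[of u] by (auto simp: indicator_def std_normal_cdf_quantile)
  qed
  also have "\<dots> = (LBINT x. g (std_normal_cdf x) * indicator {?Q a..?Q b} x)"
  proof (rule integral_substitution(2)[symmetric])
    show "set_integrable lborel {?Q a..?Q b} (\<lambda>x. g (std_normal_cdf x))"
      using std_normal_cdf_range
      by (intro borel_integrable_atLeastAtMost' continuous_on_compose2[OF cont]
          continuous_at_imp_continuous_on) (auto intro: isCont_std_normal_cdf)
    show "(?Q has_real_derivative ?Q' u) (at u)" if "u \<in> {a..b}" for u
      using DERIV_std_normal_quantile[of u] deriv_std_normal_quantile[of u] unit[OF that] by simp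
    show "continuous_on {a..b} ?Q'"
      by (rule continuous_on_subset[OF continuous_on_deriv_std_normal_quantile]) (use unit in auto)
    show "0 \<le> ?Q' u" if "u \<in> {a..b}" for u
      using deriv_std_normal_quantile_pos[of u] unit[OF that] by simp
  qed fact
  also have "\<dots> = (LBINT x. g (std_normal_cdf x))"
  proof (rule Bochner_Integration.integral_cong[OF refl])
    fix x :: real
    show "g (std_normal_cdf x) * indicator {?Q a..?Q b} x = g (std_normal_cdf x)"
      using supp[OF std_normal_cdf_range, of x] in_iff[of x] by (auto simp: indicator_def)
  qed
  finally show ?thesis .
qed

text \<open>
  The integrand is a step function with steps of width \<open>1 / h\<close>. This turns a sum over indices into an
  integral over the position in the window.
\<close>

lemma has_bochner_integral_floor:
  fixes G :: "nat \<Rightarrow> real" and h c :: real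
  assumes "0 < h" and G: "G 0 = 0" "\<And>k. n < k \<Longrightarrow> G k = 0"
  shows "has_bochner_integral lborel (\<lambda>x. G (nat (\<lfloor>c + x * h\<rfloor> + 1))) (1 / h * (\<Sum>k=1..n. G k))"
proof -
  define I where "I k = {(real k - 1 - c) / h..<(real k - c) / h}" for k :: nat
  have "has_bochner_integral lborel (\<lambda>x. \<Sum>k=1..n. G k * indicator (I k) x) (\<Sum>k=1..n. G k * (1 / h))"
  proof (intro has_bochner_integral_sum has_bochner_integral_mult_right)
    fix k
    have le: "(real k - 1 - c) / h \<le> (real k - c) / h"
      using \<open>0 < h\<close> by (intro divide_right_mono) auto
    have "(real k - c) / h - (real k - 1 - c) / h = 1 / h"
      by (simp flip: diff_divide_distrib)
    then have "emeasure lborel (I k) = ennreal (1 / h)"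
      unfolding I_def by (subst emeasure_lborel_Ico[OF le]) simp
    then show "has_bochner_integral lborel (indicator (I k)) (1 / h)"
      using \<open>0 < h\<close> has_bochner_integral_real_indicator[of "I k" lborel]
      by (auto simp: measure_def I_def)
  qed
  moreover have "(\<Sum>k=1..n. G k * indicator (I k) x) = G (nat (\<lfloor>c + x * h\<rfloor> + 1))" for x
  proof -
    define N where "N = nat (\<lfloor>c + x * h\<rfloor> + 1)"
    have "x \<in> I k \<longleftrightarrow> N = k" if "1 \<le> k" for k
    proof -
      have "x \<in> I k \<longleftrightarrow> real k - 1 \<le> c + x * h \<and> c + x * h < real k"
        using \<open>0 < h\<close> by (auto simp: I_def pos_divide_le_eq pos_less_divide_eq)
      also have "\<dots> \<longleftrightarrow> \<lfloor>c + x * h\<rfloor> = int k - 1"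
        by (simp add: floor_eq_iff)
      also have "\<dots> \<longleftrightarrow> N = k"
        using that by (auto simp: N_def)
      finally show ?thesis .
    qed
    then have "(\<Sum>k=1..n. G k * indicator (I k) x) = (\<Sum>k=1..n. if N = k then G k else 0)"
      by (intro sum.cong) auto
    also have "\<dots> = G N"
      using G by (cases "N = 0"; cases "N \<le> n") (auto simp: sum.delta')
    finally show ?thesis by (simp add: N_def)
  qed
  ultimately show ?thesis
    by (simp add: sum_distrib_left mult.commute)
qed

text \<open>
  A test function vanishes outside some \<open>{a..b}\<close> inside the open unit interval. As the break points are
  monotone in the index, once those in the windows of two points \<open>x0\<close> and \<open>x1\<close> have left \<open>{a..b}\<close> on
  either side, the step functions to be integrated vanish outside \<open>{x0..x1}\<close>; this gives the dominating
  function.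
\<close>

lemma vague_conv_break_empirical:
  fixes P :: "nat \<Rightarrow> nat \<Rightarrow> real" and p s :: real
  assumes P: "\<And>n k. 1 \<le> k \<Longrightarrow> k \<le> n \<Longrightarrow> P n k \<in> {0..1}" and "0 < s"
    and lim: "\<And>x. (\<lambda>n. break_point P n (nat (\<lfloor>real n * p + x * sqrt (real n * s)\<rfloor> + 1))) \<longlonglongrightarrow> std_normal_cdf x"
  shows "vague_conv_on {0<..<1} (\<lambda>n. scale_measure (ennreal (sqrt (real n) / sqrt s)) (break_empirical P n))
    (density (restrict_space lborel {0<..<1}) (\<lambda>u. ennreal (deriv std_normal_quantile u)))"
  unfolding vague_conv_on_def
proof (intro conjI allI impI radon_scaled_break_empirical radon_quantile_density; elim conjE exE)
  fix f :: "real \<Rightarrow> real" and K :: "real set"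
  assume f: "continuous_on {0<..<1} f" and K: "compact K" "K \<subseteq> {0<..<1}" "\<forall>x\<in>{0<..<1} - K. f x = 0"
  define W where "W n x = nat (\<lfloor>real n * p + x * sqrt (real n * s)\<rfloor> + 1)" for n x
  define g where "g u = indicator {0<..<1} u * f u" for u
  have W_mono: "W n x \<le> W n y" if "x \<le> y" for n x y
    using that \<open>0 < s\<close> unfolding W_def
    by (intro nat_mono add_right_mono floor_mono add_left_mono mult_right_mono) auto
  have A_mono: "break_point P n k \<le> break_point P n l" if "k \<le> l" for n k l
    by (rule break_point_mono[OF P that])
  obtain a b where ab: "0 < a" "a \<le> b" "b < 1" "K \<subseteq> {a..b}"
  proof (cases "K = {}")
    case True
    then show ?thesis using that[of "1/2" "1/2"] by simp
  next
    case False
    obtain a where a: "a \<in> K" "\<And>u. u \<in> K \<Longrightarrow> a \<le> u"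
      using compact_attains_inf[OF K(1) False] by blast
    obtain b where b: "b \<in> K" "\<And>u. u \<in> K \<Longrightarrow> u \<le> b"
      using compact_attains_sup[OF K(1) False] by blast
    show ?thesis
      using that[of a b] a b K(2) by force
  qed
  have f_supp: "f u = 0" if "0 < u" "u < 1" "u \<notin> {a..b}" for u
  proof -
    have "u \<in> {0<..<1} - K" using that ab(4) by auto
    then show ?thesis using K(3) by blast
  qed
  then have supp: "g u = 0" if "u \<notin> {a..b}" for u
    using that by (auto simp: g_def indicator_def)
  have "compact (f ` {a..b})"
    using ab by (intro compact_continuous_image continuous_on_subset[OF f]) auto
  then obtain C where "\<And>u. u \<in> {a..b} \<Longrightarrow> norm (f u) \<le> C"
    using compact_imp_bounded bounded_iff by (metis imageI)
  then have C: "\<bar>g u\<bar> \<le> C" if "u \<in> {a..b}" for u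
    using that ab by (auto simp: g_def)
  have g_lim: "(\<lambda>n. g (break_point P n (W n x))) \<longlonglongrightarrow> g (std_normal_cdf x)" for x
  proof -
    have "continuous_on {0<..<1} g"
      using f by (rule continuous_on_eq) (simp add: g_def)
    then have "isCont g (std_normal_cdf x)"
      using std_normal_cdf_range[of x] by (subst (asm) continuous_on_eq_continuous_at) auto
    then show ?thesis
      using lim[of x] unfolding W_def by (rule isCont_tendsto_compose)
  qed
  have step: "has_bochner_integral lborel (\<lambda>x. g (break_point P n (W n x)))
      (1 / sqrt (n * s) * (\<Sum>k=1..n. g (break_point P n k)))" if "0 < n" for n
    unfolding W_def using that \<open>0 < s\<close>
    by (intro has_bochner_integral_floor[where G = "\<lambda>k. g (break_point P n k)"])
      (auto simp: g_def break_point_beyond)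
  \<comment> \<open>Any points with \<open>std_normal_cdf x0 < a\<close> and \<open>b < std_normal_cdf x1\<close> would do.\<close>
  define x0 x1 where "x0 = std_normal_quantile (a / 2)" and "x1 = std_normal_quantile ((1 + b) / 2)"
  have "\<forall>\<^sub>F n in sequentially. break_point P n (W n x0) < a"
    using ab std_normal_cdf_quantile[of "a / 2"]
    by (intro order_tendstoD(2)[OF lim[of x0, folded W_def]]) (simp add: x0_def)
  moreover have "\<forall>\<^sub>F n in sequentially. b < break_point P n (W n x1)"
    using ab std_normal_cdf_quantile[of "(1 + b) / 2"]
    by (intro order_tendstoD(1)[OF lim[of x1, folded W_def]]) (simp add: x1_def)
  ultimately have "\<forall>\<^sub>F n in sequentially. 0 < n \<and> break_point P n (W n x0) < a \<and> b < break_point P n (W n x1)"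
    using eventually_gt_at_top[of 0] by eventually_elim auto
  then obtain N where N: "\<And>n. N \<le> n \<Longrightarrow> 0 < n" "\<And>n. N \<le> n \<Longrightarrow> break_point P n (W n x0) < a"
    "\<And>n. N \<le> n \<Longrightarrow> b < break_point P n (W n x1)"
    unfolding eventually_sequentially by blast
  have "(\<lambda>n. LBINT x. g (break_point P (n + N) (W (n + N) x))) \<longlonglongrightarrow> (LBINT x. g (std_normal_cdf x))"
  proof (rule integral_dominated_convergence[where w = "\<lambda>x. C * indicator {x0..x1} x"])
    show meas: "(\<lambda>x. g (break_point P (n + N) (W (n + N) x))) \<in> borel_measurable lborel" for n
      by (rule borel_measurable_has_bochner_integral[OF step]) (simp add: N(1))
    show "(\<lambda>x. g (std_normal_cdf x)) \<in> borel_measurable lborel"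
      by (rule borel_measurable_LIMSEQ_real[OF LIMSEQ_ignore_initial_segment[OF g_lim] meas])
    show "AE x in lborel. norm (g (break_point P (n + N) (W (n + N) x))) \<le> C * indicator {x0..x1} x" for n
    proof (rule AE_I2)
      fix x
      let ?u = "break_point P (n + N) (W (n + N) x)"
      show "norm (g ?u) \<le> C * indicator {x0..x1} x"
      proof (cases "?u \<in> {a..b}")
        case True
        have "x0 \<le> x"
          using N(2)[of "n + N"] True A_mono[OF W_mono[of x x0 "n + N"], of "n + N"] by fastforce
        moreover have "x \<le> x1"
          using N(3)[of "n + N"] True A_mono[OF W_mono[of x1 x "n + N"], of "n + N"] by fastforce
        ultimately show ?thesis
          using C[OF True] by simp
      next
        case False
        moreover have "0 \<le> C" using C[of a] ab by force
        ultimately show ?thesis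
          using supp by (simp add: indicator_def)
      qed
    qed
    show "AE x in lborel. (\<lambda>n. g (break_point P (n + N) (W (n + N) x))) \<longlonglongrightarrow> g (std_normal_cdf x)"
      using LIMSEQ_ignore_initial_segment[OF g_lim] by simp
    show "integrable lborel (\<lambda>x. C * indicator {x0..x1} x)"
      by (intro integrable_mult_right integrable_real_indicator) (auto simp: emeasure_lborel_Icc_eq)
  qed
  then have "(\<lambda>n. LBINT x. g (break_point P n (W n x))) \<longlonglongrightarrow> (LBINT x. g (std_normal_cdf x))"
    by (rule LIMSEQ_offset)
  moreover have "\<forall>\<^sub>F n in sequentially. (LBINT x. g (break_point P n (W n x))) =
      (\<integral>u. f u \<partial>(scale_measure (ennreal (sqrt (real n) / sqrt s)) (break_empirical P n)))"
    using eventually_gt_at_top[of 0]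
  proof eventually_elim
    case (elim n)
    have "(\<integral>u. f u \<partial>(scale_measure (ennreal (sqrt (real n) / sqrt s)) (break_empirical P n))) =
        sqrt (real n) / sqrt s / n * (\<Sum>k=1..n. g (break_point P n k))"
      unfolding g_def using \<open>0 < s\<close>
      by (intro integral_scaled_break_empirical borel_measurable_continuous_on_unit(2) f) auto
    also have "sqrt (real n) / sqrt s / n = 1 / sqrt (n * s)"
      using elim \<open>0 < s\<close> by (simp add: real_sqrt_mult field_simps)
    finally show ?case
      using step[OF elim] by (simp add: has_bochner_integral_integral_eq)
  qed
  ultimately have "(\<lambda>n. \<integral>u. f u \<partial>(scale_measure (ennreal (sqrt (real n) / sqrt s)) (break_empirical P n)))
      \<longlonglongrightarrow> (LBINT x. g (std_normal_cdf x))"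
    by (rule Lim_transform_eventually)
  also have "(LBINT x. g (std_normal_cdf x)) = (LBINT x. f (std_normal_cdf x))"
    using std_normal_cdf_range by (simp add: g_def)
  also have "\<dots> = (\<integral>u. f u \<partial>(density (restrict_space lborel {0<..<1}) (\<lambda>u. ennreal (deriv std_normal_quantile u))))"
    by (rule integral_quantile_density[symmetric, OF ab(1-3) f f_supp])
  finally show "(\<lambda>n. \<integral>u. f u \<partial>(scale_measure (ennreal (sqrt (real n) / sqrt s)) (break_empirical P n)))
      \<longlonglongrightarrow> (\<integral>u. f u \<partial>(density (restrict_space lborel {0<..<1}) (\<lambda>u. ennreal (deriv std_normal_quantile u))))" .
qed

theorem theorem4p5:
  fixes M :: "'a measure"
    and P :: "nat \<Rightarrow> nat \<Rightarrow> 'a \<Rightarrow> real"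
    and pbar s :: real
  assumes "prob_space M"
    and indep: "prob_space.indep_vars M (\<lambda>_. borel) (\<lambda>(n, k). P n k) {(n, k). 1 \<le> k \<and> k \<le> n}"
    and ident: "\<And>n k. 1 \<le> k \<Longrightarrow> k \<le> n \<Longrightarrow> distr M borel (P n k) = distr M borel (P 1 1)"
    and range: "\<And>n k \<omega>. 1 \<le> k \<Longrightarrow> k \<le> n \<Longrightarrow> \<omega> \<in> space M \<Longrightarrow> P n k \<omega> \<in> {0..1}"
    and pbar: "pbar = (\<integral>\<omega>. P 1 1 \<omega> \<partial>M)"
    and s: "s = pbar * (1 - pbar)"
    and nondeg: "measure M {\<omega> \<in> space M. P 1 1 \<omega> \<in> {0<..<1}} > 0"
  shows "AE \<omega> in M.
    vague_conv_on {0<..<1}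
      (\<lambda>n. scale_measure (ennreal (sqrt (real n) / sqrt s)) (break_empirical (\<lambda>m k. P m k \<omega>) n))
      (density (restrict_space lborel {0<..<1}) (\<lambda>u. ennreal (deriv std_normal_quantile u)))"
proof -
  interpret splitting_array M P pbar
    by (intro splitting_array.intro splitting_array_axioms.intro assms(1) indep ident range
        pbar[symmetric] nondeg)
  have "0 < s"
    using p_in by (simp add: s)
  from AE_break_point_tendsto AE_space show ?thesis
  proof eventually_elim
    case (elim \<omega>)
    show ?case
    proof (rule vague_conv_break_empirical[where p = pbar])
      show "P n k \<omega> \<in> {0..1}" if "1 \<le> k" "k \<le> n" for n k
        using range that elim(2) by blast
      show "(\<lambda>n. break_point (\<lambda>m k. P m k \<omega>) n (nat (\<lfloor>real n * pbar + x * sqrt (real n * s)\<rfloor> + 1)))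
          \<longlonglongrightarrow> std_normal_cdf x" for x
        using elim(1) by (simp add: A_def window_def s)
    qed fact
  qed
qed

end
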